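(* Let $R$ be a unique factorization domain whose fraction field $K$ is a field with the product formula, with $K$ imperfect (i.e. $K^p\neq K$) if $K$ is of characteristic $p>0$. Let $n\geq 1$ and $\underline x=(x_1,\ldots,x_n)$. Then every nonconstant polynomial $\mathcal Q\in R[\underline x]$ is the sum $\mathcal Q=F+G$ of two irreducible polynomials $F,G\in R[\underline x]$ with $F=a+b\,x_1^{d_1}\cdots x_n^{d_n}$ ($a,b\in R$) a binomial of degree $d_1+\cdots+d_n\leq\deg(\mathcal Q)$.
   Context: A field $K$ is a field with the product formula if there is a nonempty set $S$ of primes $\mathfrak p$ of $K$ (equivalence classes of nontrivial absolute values, each with a chosen associated absolute value $|\cdot|_{\mathfrak p}$) and for each $\mathfrak p\in S$ a real number $\beta_{\mathfrak p}>0$ such that for each $a\in K^\times$ the set $\{\mathfrak p\in S : |a|_{\mathfrak p}\neq 1\}$ is finite and $\prod_{\mathfrak p\in S}|a|_{\mathfrak p}^{\beta_{\mathfrak p}}=1$. Here $\deg$ denotes total degree in $\underline x$. *)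

theory Defs
  imports
    Complex_Main
    "HOL-Library.Poly_Mapping"
    "HOL-Computational_Algebra.Factorial_Ring"
    "HOL-Computational_Algebra.Fraction_Field"
begin

section \<open>Fields with the product formula\<close>

definition absolute_value :: "('k::field \<Rightarrow> real) \<Rightarrow> bool" where
  "absolute_value v \<longleftrightarrow>
     (\<forall>x. 0 \<le> v x) \<and>
     (\<forall>x. v x = 0 \<longleftrightarrow> x = 0) \<and>
     (\<forall>x y. v (x * y) = v x * v y) \<and>
     (\<forall>x y. v (x + y) \<le> v x + v y)"

definition nontrivial_absolute_value :: "('k::field \<Rightarrow> real) \<Rightarrow> bool" where
  "nontrivial_absolute_value v \<longleftrightarrow> absolute_value v \<and> (\<exists>x. x \<noteq> 0 \<and> v x \<noteq> 1)"

definition abs_val_equiv :: "(('k::field \<Rightarrow> real) \<times> ('k \<Rightarrow> real)) set" where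
  "abs_val_equiv = {(v, w). nontrivial_absolute_value v \<and> nontrivial_absolute_value w \<and>
     (\<forall>x. v x < 1 \<longleftrightarrow> w x < 1)}"

lemma equiv_abs_val_equiv: "equiv {v. nontrivial_absolute_value v} abs_val_equiv"
  by (rule equivI) (auto simp: abs_val_equiv_def refl_on_def sym_def trans_def)

definition field_primes :: "('k::field \<Rightarrow> real) set set" where
  "field_primes = {v. nontrivial_absolute_value v} // abs_val_equiv"

text \<open>
  In the following, \<open>nv P\<close> is the absolute value chosen in the class \<open>P\<close>.
  The product over the possibly infinite set \<open>S\<close> is the product of its
  finitely many factors different from 1.
\<close>

definition product_formula_field :: "'k::field itself \<Rightarrow> bool" where
  "product_formula_field _ \<longleftrightarrow>
     (\<exists>(S :: ('k \<Rightarrow> real) set set) nv (\<beta> :: ('k \<Rightarrow> real) set \<Rightarrow> real).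
        S \<noteq> {} \<and> S \<subseteq> field_primes \<and>
        (\<forall>P\<in>S. nv P \<in> P) \<and>
        (\<forall>P\<in>S. \<beta> P > 0) \<and>
        (\<forall>a. a \<noteq> 0 \<longrightarrow>
           finite {P\<in>S. nv P a \<noteq> 1} \<and>
           (\<Prod>P | P \<in> S \<and> nv P a \<noteq> 1. nv P a powr \<beta> P) = 1))"

section \<open>Polynomials in finitely many variables\<close>

text \<open>
  The variables are indexed by a finite (hence nonempty) type \<open>'n\<close>; a monomial is its
  exponent vector, and the ring structure on \<open>mpoly\<close> is the convolution product of
  \<^theory>\<open>HOL-Library.Poly_Mapping\<close>, so that \<^const>\<open>irreducible\<close> on this type is
  irreducibility in the ring of polynomials over \<open>'r\<close>.
\<close>

type_synonym ('n, 'r) mpoly = "('n \<Rightarrow>\<^sub>0 nat) \<Rightarrow>\<^sub>0 'r"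

definition monom_degree :: "('n::finite \<Rightarrow>\<^sub>0 nat) \<Rightarrow> nat" where
  "monom_degree d = (\<Sum>i\<in>UNIV. Poly_Mapping.lookup d i)"

text \<open>The zero polynomial gets degree 0.\<close>

definition total_degree :: "('n::finite, 'r::zero) mpoly \<Rightarrow> nat" where
  "total_degree p = Max (insert 0 (monom_degree ` Poly_Mapping.keys p))"

abbreviation mpoly_term :: "'r::zero \<Rightarrow> ('n::finite \<Rightarrow>\<^sub>0 nat) \<Rightarrow> ('n, 'r) mpoly" where
  "mpoly_term c d \<equiv> Poly_Mapping.single d c"

abbreviation mpoly_const :: "'r::zero \<Rightarrow> ('n::finite, 'r) mpoly" where
  "mpoly_const c \<equiv> mpoly_term c 0"

end

theory Submission
  imports Defs "HOL-Computational_Algebra.Polynomial"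
begin

text \<open>
  Take \<open>F = a + b x\<close> for a single variable \<open>x\<close>. A substitution \<open>x\<^sub>i = u\<^sub>i y\<close> that preserves the
  total degree reduces the irreducibility of \<open>G = Q - a - b x\<close> over the fraction field to that of
  a polynomial in \<open>y\<close> whose linear coefficient moves with \<open>b\<close>. If this coefficient dominates at an
  absolute value, one root is small and all others are large. In a factorization, the small roots
  at the various absolute values may be shared between the factors; comparing two values of \<open>b\<close>
  that differ by a constant, the product formula excludes this as well. No Hilbert irreducibility
  theorem is needed.
\<close>

section \<open>Absolute values on domains\<close>

text \<open>The product formula is effective only against bounds that equal 1 at almost all primes
  and depend neither on the unknown factors nor on the size of the translate. This shapes the proof.
  One element \<open>t\<close> singles out the finite set \<open>T\<close> of primes where it
  exceeds 1. Large powers of \<open>t\<close> make the linear coefficient dominate at all of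
  \<open>T\<close>, while at the other primes they stay at most 1, so the bounds there are
  independent of the exponent. Factors are controlled through their values at finitely many fixed
  nodes, by one argument for archimedean and ultrametric values; its constants are products of
  \<open>v P a\<close> and inverses, hence 1 almost everywhere. Nonconstant factors over the
  fraction field are one issue, constant factors in \<open>R\<close> another: the latter are
  excluded by choosing \<open>a\<close> and \<open>b\<close> so that the coefficients of
  \<open>F\<close>, and also those of \<open>G\<close>, generate the unit ideal.\<close>

lemma one_le_mult: "1 \<le> a \<Longrightarrow> 1 \<le> b \<Longrightarrow> 1 \<le> a * (b :: real)"
  using mult_mono[of 1 a 1 b] by simp

text \<open>Removes losses by passing to powers: it serves whenever an estimate is multiplicative up
  to a factor linear in the exponent.\<close>

lemma le_1_if_powers_le_linear:
  fixes c :: real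
  assumes "0 \<le> c" and bound: "\<And>j. c ^ j \<le> K * (real j + 1)"
  shows "c \<le> 1"
proof (rule ccontr)
  assume "\<not> c \<le> 1"
  \<comment> \<open>Bernoulli is applied to the square root of \<open>c\<close>: squaring its linear
    bound gives quadratic growth in \<open>j\<close>, which beats the linear upper bound.\<close>
  define s where "s = sqrt c - 1"
  have s: "s > 0" and c: "c = (1 + s)\<^sup>2"
    using \<open>\<not> c \<le> 1\<close> by (auto simp: s_def)
  have lin: "real j * s\<^sup>2 \<le> 2 * K" if "j > 0" for j
  proof -
    have "real j * s \<le> (1 + s) ^ j"
      using Bernoulli_inequality[of s j] s by auto
    hence "(real j * s)\<^sup>2 \<le> ((1 + s) ^ j)\<^sup>2"
      using s by (intro power_mono) auto
    also have "\<dots> = c ^ j"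
      by (simp add: c power_mult [symmetric] mult.commute)
    also have "\<dots> \<le> K * (real j + 1)" by (rule bound)
    also have "\<dots> \<le> K * (2 * real j)"
      using bound[of 0] that by (intro mult_left_mono) auto
    finally show ?thesis
      using that by (simp add: power2_eq_square mult_ac)
  qed
  obtain j where j: "2 * K < real j * s\<^sup>2"
    using reals_Archimedean3[of "s\<^sup>2"] s by auto
  moreover have "j > 0"
    using j bound[of 0] by (cases j) auto
  ultimately show False
    using lin[of j] by linarith
qed

text \<open>Stated on a domain because the polynomials and their factors have coefficients in
  \<open>'r\<close>; absolute values of the fraction field enter only by restriction.\<close>

locale domain_abs =
  fixes v :: "'r::idom \<Rightarrow> real"
  assumes nonneg [simp]: "0 \<le> v x"
    and eq_0_iff [simp]: "v x = 0 \<longleftrightarrow> x = 0"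
    and mult: "v (x * y) = v x * v y"
    and triangle: "v (x + y) \<le> v x + v y"
begin

lemma zero [simp]: "v 0 = 0"
  by simp

lemma one [simp]: "v 1 = 1"
  using mult[of 1 1] by simp

lemma minus [simp]: "v (- x) = v x"
proof -
  have "v (- 1) * v (- 1) = 1"
    using mult[of "- 1" "- 1"] by simp
  hence "v (- 1) = 1"
    using nonneg[of "- 1"] square_eq_1_iff[of "v (- 1)"] by auto
  thus ?thesis
    using mult[of "- 1" x] by simp
qed

lemma power: "v (x ^ n) = v x ^ n"
  by (induction n) (auto simp: mult)

lemma pos_iff [simp]: "0 < v x \<longleftrightarrow> x \<noteq> 0"
  using nonneg[of x] eq_0_iff[of x] by linarith

lemma triangle_diff: "v (x - y) \<le> v x + v y"
  using triangle[of x "- y"] by simp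

lemma diff_ge: "v x - v y \<le> v (x + y)"
  using triangle_diff[of "x + y" y] by simp

lemma sum_le: "v (sum f A) \<le> (\<Sum>a\<in>A. v (f a))"
proof (induction A rule: infinite_finite_induct)
  case (insert a A)
  thus ?case using triangle[of "f a" "sum f A"] by simp
qed auto

section \<open>Archimedean and ultrametric absolute values, after Ostrowski\<close>

lemma of_nat_less_pow2:
  assumes "v 2 \<le> 1"
  shows "n < 2 ^ k \<Longrightarrow> v (of_nat n) \<le> real k"
proof (induction k arbitrary: n)
  case (Suc k)
  \<comment> \<open>Binary expansion: doubling does not increase the value, so each digit adds at
    most 1.\<close>
  have "v (of_nat n) = v (2 * of_nat (n div 2) + of_nat (n mod 2))"
    by (metis mult_div_mod_eq of_nat_add of_nat_mult of_nat_numeral)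
  also have "\<dots> \<le> v 2 * v (of_nat (n div 2)) + v (of_nat (n mod 2))"
    using triangle by (metis mult)
  also have "v (of_nat (n div 2)) \<le> real k"
    using Suc by auto
  hence "v 2 * v (of_nat (n div 2)) \<le> 1 * real k"
    using assms by (intro mult_mono) auto
  also have "v (of_nat (n mod 2)) \<le> 1"
    by (cases "n mod 2 = 0") (auto simp: not_mod_2_eq_0_eq_1)
  finally show ?case by simp
qed auto

lemma of_nat_le_1:
  assumes "v 2 \<le> 1"
  shows "v (of_nat n) \<le> 1"
proof (rule le_1_if_powers_le_linear)
  fix j
  have "v (of_nat n) ^ j = v (of_nat (n ^ j))"
    by (simp add: power)
  \<comment> \<open>The number of binary digits of \<open>n ^ j\<close> is at most
    \<open>n * j + 1\<close>, linear in \<open>j\<close>.\<close>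
  also have "n < 2 ^ n" by (rule less_exp)
  hence "n ^ j \<le> 2 ^ (n * j)"
    by (metis less_imp_le power_mono power_mult zero_le)
  hence "n ^ j < 2 ^ (n * j + 1)"
    by (rule le_less_trans) simp
  hence "v (of_nat (n ^ j)) \<le> real (n * j + 1)"
    by (rule of_nat_less_pow2[OF assms])
  also have "\<dots> \<le> (real n + 1) * (real j + 1)"
    by (simp add: algebra_simps)
  finally show "v (of_nat n) ^ j \<le> (real n + 1) * (real j + 1)" .
qed auto

text \<open>Binomial coefficients have value at most 1, so the expansion of
  \<open>(x + y) ^ j\<close> has \<open>j + 1\<close> terms bounded by \<open>M ^ j\<close>; the
  factor \<open>j + 1\<close> disappears under powers.\<close>

lemma ultrametric:
  assumes "v 2 \<le> 1"
  shows "v (x + y) \<le> max (v x) (v y)"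
proof (cases "x = 0 \<and> y = 0")
  case False
  define M where "M = max (v x) (v y)"
  have M: "M > 0" "v x \<le> M" "v y \<le> M"
    using False by (auto simp: M_def less_max_iff_disj)
  have "v (x + y) / M \<le> 1"
  proof (rule le_1_if_powers_le_linear[where K = 1])
    fix j
    have "v (x + y) ^ j = v (\<Sum>k\<le>j. of_nat (j choose k) * x ^ k * y ^ (j - k))"
      by (simp add: binomial_ring flip: power)
    also have "\<dots> \<le> (\<Sum>k\<le>j. v (of_nat (j choose k) * x ^ k * y ^ (j - k)))"
      by (rule sum_le)
    also have "\<dots> \<le> (\<Sum>k\<le>j. 1 * M ^ k * M ^ (j - k))"
      unfolding mult power
      using M by (intro sum_mono mult_mono power_mono of_nat_le_1 assms) auto
    also have "\<dots> = (real j + 1) * M ^ j"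
      by (simp flip: power_add)
    finally show "(v (x + y) / M) ^ j \<le> 1 * (real j + 1)"
      using M by (simp add: power_divide field_simps)
  qed (use M in auto)
  thus ?thesis
    using M by (simp add: M_def)
qed auto

text \<open>The value 2 would be a valid bound everywhere, but products over all primes require the
  constant 1 at almost all of them.\<close>

definition triangle_const :: real where
  "triangle_const = (if v 2 \<le> 1 then 1 else 2)"

lemma triangle_const_ge_1: "1 \<le> triangle_const"
  unfolding triangle_const_def by auto

lemma quasi_ultrametric: "v (x + y) \<le> triangle_const * max (v x) (v y)"
proof (cases "v 2 \<le> 1")
  case False
  thus ?thesis
    using triangle[of x y] by (simp add: triangle_const_def)
qed (simp add: triangle_const_def ultrametric)

lemma add_le: "v x \<le> M \<Longrightarrow> v y \<le> M \<Longrightarrow> v (x + y) \<le> triangle_const * M"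
  using quasi_ultrametric[of x y] triangle_const_ge_1 max.boundedI[of "v x" M "v y"]
    mult_left_mono[of "max (v x) (v y)" M triangle_const] by linarith

lemma diff_le: "v x \<le> M \<Longrightarrow> v y \<le> M \<Longrightarrow> v (x - y) \<le> triangle_const * M"
  using add_le[of x M "- y"] by simp

end

section \<open>Coefficients of polynomials against values at finitely many nodes\<close>

locale interpolation_nodes = domain_abs v for v :: "'r::idom \<Rightarrow> real" +
  fixes X :: "'r set" and W Z :: real
  assumes finite_nodes: "finite X"
    and W_ge_1: "1 \<le> W" and node_le: "x \<in> X \<Longrightarrow> v x \<le> W"
    and Z_ge_1: "1 \<le> Z" and node_diff: "x \<in> X \<Longrightarrow> y \<in> X \<Longrightarrow> x \<noteq> y \<Longrightarrow> 1 \<le> Z * v (x - y)"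
begin

text \<open>The cost of one interpolation step: \<open>triangle_const * Z\<close> for a divided
  difference and \<open>triangle_const * W\<close> for multiplying back by
  \<open>x - y\<close>.\<close>

definition L :: real where "L = triangle_const\<^sup>2 * W * Z"

lemma triangle_const_W_le_L: "triangle_const * W \<le> L"
proof -
  have "triangle_const * W * 1 \<le> triangle_const * W * (triangle_const * Z)"
    using triangle_const_ge_1 W_ge_1 Z_ge_1 by (intro mult_left_mono one_le_mult) auto
  thus ?thesis
    by (simp add: L_def power2_eq_square mult_ac)
qed

lemma L_ge_1: "1 \<le> L"
  using one_le_mult[OF triangle_const_ge_1 W_ge_1] triangle_const_W_le_L by linarith

text \<open>Newton interpolation: splitting off the node \<open>y\<close> leaves the divided
  difference \<open>q\<close>, of smaller degree and with controlled values at the remaining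
  nodes.\<close>

lemma coeff_le_if_values_le:
  assumes "Y \<subseteq> X" "card Y = Suc n" "degree p \<le> n" "\<And>y. y \<in> Y \<Longrightarrow> v (poly p y) \<le> \<mu>"
  shows "v (coeff p i) \<le> L ^ n * \<mu>"
  using assms
proof (induction n arbitrary: Y p \<mu> i)
  case 0
  then obtain y c where "Y = {y}" "p = [:c:]"
    by (auto simp: card_Suc_eq elim: degree_eq_zeroE)
  moreover from this 0 have "v c \<le> \<mu>" by simp
  moreover from this have "0 \<le> \<mu>"
    using nonneg[of c] by linarith
  ultimately show ?case
    by (cases i) auto
next
  case (Suc n)
  obtain y Y' where Y: "Y = insert y Y'" "y \<notin> Y'" "card Y' = Suc n"
    using Suc.prems(2) by (metis card_Suc_eq)
  define q where "q = synthetic_div p y"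
  have p: "[:- y, 1:] * q + [:poly p y:] = p"
    unfolding q_def by (rule synthetic_div_correct')
  have py: "v (poly p y) \<le> \<mu>"
    using Suc.prems(4) Y by simp
  hence \<mu>: "0 \<le> \<mu>"
    using nonneg[of "poly p y"] by linarith
  have q_le: "v (poly q x) \<le> triangle_const * Z * \<mu>" if "x \<in> Y'" for x
  proof -
    have "poly p x - poly p y = (x - y) * poly q x"
      by (subst (1) p [symmetric]) (simp add: algebra_simps)
    hence "v (x - y) * v (poly q x) = v (poly p x - poly p y)"
      by (simp add: mult)
    also have "\<dots> \<le> triangle_const * \<mu>"
      using Suc.prems(4) Y that py by (intro diff_le) auto
    finally have *: "v (x - y) * v (poly q x) \<le> triangle_const * \<mu>" .
    have "1 * v (poly q x) \<le> Z * v (x - y) * v (poly q x)"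
      using Y that Suc.prems(1) by (intro mult_right_mono node_diff) auto
    also have "\<dots> \<le> Z * (triangle_const * \<mu>)"
      unfolding mult.assoc using * Z_ge_1 by (intro mult_left_mono) auto
    finally show ?thesis by (simp add: mult_ac)
  qed
  have IH: "v (coeff q j) \<le> L ^ n * (triangle_const * Z * \<mu>)" for j
    using Suc.prems Y q_le by (intro Suc.IH[of Y']) (auto simp: q_def degree_synthetic_div)
  define B where "B = W * (L ^ n * (triangle_const * Z * \<mu>))"
  have "1 \<le> L ^ n * (triangle_const * Z)"
    using L_ge_1 triangle_const_ge_1 Z_ge_1 by (intro one_le_mult one_le_power)
  from mult_right_mono[OF this \<mu>] have 1: "\<mu> \<le> L ^ n * (triangle_const * Z * \<mu>)"
    by (simp add: mult_ac)
  have 2: "L ^ n * (triangle_const * Z * \<mu>) \<le> B"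
    using mult_right_mono[OF W_ge_1, of "L ^ n * (triangle_const * Z * \<mu>)"] 1 \<mu> by (simp add: B_def)
  have "v y * v (coeff q i) \<le> B"
    unfolding B_def using Y Suc.prems(1) W_ge_1 by (intro mult_mono IH node_le) auto
  hence 3: "v (y * coeff q i) \<le> B"
    by (simp add: mult)
  have "v (coeff p i) \<le> triangle_const * B"
  proof (cases i)
    case 0
    have "coeff p i = poly p y - y * coeff q i"
      by (subst p [symmetric]) (simp add: 0)
    thus ?thesis
      using 1 2 3 py by (auto intro!: diff_le)
  next
    case (Suc k)
    have "coeff p i = coeff q k - y * coeff q i"
      by (subst p [symmetric]) (simp add: Suc)
    thus ?thesis
      using 2 3 IH[of k] by (auto intro!: diff_le)
  qed
  also have "triangle_const * B = L ^ Suc n * \<mu>"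
    by (simp add: B_def L_def power2_eq_square mult_ac)
  finally show ?case .
qed

text \<open>Horner's scheme, where each step costs \<open>triangle_const * W\<close>, which is at
  most \<open>L\<close>.\<close>

lemma value_le:
  assumes "x \<in> X" "degree f \<le> n" "\<And>k. v (coeff f k) \<le> M"
  shows "v (poly f x) \<le> L ^ n * M"
  using assms(2,3)
proof (induction n arbitrary: f)
  case 0
  then obtain c where "f = [:c:]"
    by (auto elim: degree_eq_zeroE)
  thus ?case using 0(2)[of 0] by simp
next
  case (Suc n)
  obtain a g where f: "f = pCons a g"
    by (cases f)
  have M: "v a \<le> M" "v (coeff g k) \<le> M" for k
    using Suc.prems(2)[of 0] Suc.prems(2)[of "Suc k"] by (auto simp: f)
  hence "0 \<le> M"
    using nonneg[of a] by linarith
  have "degree g \<le> n"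
    using Suc.prems(1) by (auto simp: f split: if_splits)
  hence "v (poly g x) \<le> L ^ n * M"
    using M(2) by (rule Suc.IH)
  hence "v (x * poly g x) \<le> W * (L ^ n * M)"
    unfolding mult using W_ge_1 \<open>x \<in> X\<close> by (intro mult_mono node_le) auto
  moreover have "1 * M \<le> W * L ^ n * M"
    using W_ge_1 L_ge_1 \<open>0 \<le> M\<close> by (intro mult_right_mono one_le_mult one_le_power) auto
  ultimately have "v (poly f x) \<le> triangle_const * (W * (L ^ n * M))"
    unfolding f poly_pCons using M(1) by (intro add_le) (auto simp: mult_ac)
  also have "\<dots> = triangle_const * W * (L ^ n * M)"
    by simp
  also have "\<dots> \<le> L * (L ^ n * M)"
    using triangle_const_W_le_L L_ge_1 \<open>0 \<le> M\<close> by (intro mult_right_mono) auto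
  finally show ?case by simp
qed

text \<open>With one more such node, interpolation would bound the coefficient strictly below
  itself. The exponent \<open>D\<close> replaces \<open>degree p\<close> to keep the constant
  independent of the factor considered.\<close>

lemma card_small_values_le:
  assumes "degree p \<le> D"
  shows "card {x \<in> X. L ^ D * v (poly p x) < v (coeff p i)} \<le> degree p" (is "card ?B \<le> _")
proof (rule ccontr)
  assume "\<not> ?thesis"
  hence "Suc (degree p) \<le> card ?B" by simp
  then obtain Y where Y: "Y \<subseteq> ?B" "card Y = Suc (degree p)"
    by (rule obtain_subset_with_card_n)
  have fin: "finite Y"
    by (rule card_ge_0_finite) (simp add: Y(2))
  have "Y \<noteq> {}"
    using Y(2) by (metis card.empty nat.distinct(1))
  define \<mu> where "\<mu> = Max ((\<lambda>y. v (poly p y)) ` Y)"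
  have "v (coeff p i) \<le> L ^ degree p * \<mu>"
    using Y fin by (intro coeff_le_if_values_le[of Y]) (auto simp: \<mu>_def)
  moreover have "\<mu> \<in> (\<lambda>y. v (poly p y)) ` Y"
    unfolding \<mu>_def using fin \<open>Y \<noteq> {}\<close> by (intro Max_in) auto
  then obtain y where y: "y \<in> Y" "\<mu> = v (poly p y)"
    by auto
  moreover have "L ^ degree p * v (poly p y) \<le> L ^ D * v (poly p y)"
    using L_ge_1 assms by (intro mult_right_mono power_increasing) auto
  ultimately show False
    using Y(1) by auto
qed

text \<open>A substitute for Gelfond's inequality on heights of products, valid for every absolute value.\<close>

lemma coeff_mult_coeff_le:
  assumes "g \<noteq> 0" "h \<noteq> 0" and deg: "degree (g * h) \<le> D" and X: "D < card X"
    and M: "\<And>k. v (coeff (g * h) k) \<le> M"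
  shows "v (coeff g i) * v (coeff h j) \<le> L ^ (3 * D) * M"
proof -
  define B where "B = (\<lambda>p i. {x \<in> X. L ^ D * v (poly p x) < v (coeff p i)})"
  have gh: "degree g + degree h \<le> D"
    using deg assms by (simp add: degree_mult_eq)
  \<comment> \<open>The bad nodes of both factors together number at most
    \<open>degree g + degree h\<close>, so some node is good for both.\<close>
  have "card (B g i \<union> B h j) \<le> card (B g i) + card (B h j)"
    by (rule card_Un_le)
  also have "\<dots> \<le> degree g + degree h"
    unfolding B_def using gh by (intro add_mono card_small_values_le) auto
  also have "\<dots> < card X"
    using gh X by simp
  finally have "\<not> X \<subseteq> B g i \<union> B h j"
    using finite_nodes card_mono[of "B g i \<union> B h j" X] by (auto simp: B_def)
  then obtain x where x: "x \<in> X" "v (coeff g i) \<le> L ^ D * v (poly g x)" "v (coeff h j) \<le> L ^ D * v (poly h x)"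
    unfolding B_def by (metis (mono_tags, lifting) UnCI mem_Collect_eq not_less subsetI)
  have "v (coeff g i) * v (coeff h j) \<le> (L ^ D * v (poly g x)) * (L ^ D * v (poly h x))"
    using x L_ge_1 by (intro mult_mono) auto
  also have "\<dots> = L ^ (2 * D) * v (poly (g * h) x)"
    unfolding mult_2 power_add by (simp add: mult mult_ac)
  also have "\<dots> \<le> L ^ (2 * D) * (L ^ D * M)"
    using x(1) deg M L_ge_1 by (intro mult_left_mono value_le) auto
  also have "\<dots> = L ^ (3 * D) * M"
    by (simp flip: power_add mult.assoc)
  finally show ?thesis .
qed

text \<open>
  If the linear coefficient of a product dominates strongly enough, the product has exactly one
  small root; the factor without it has all coefficients but the constant one small.
\<close>

lemma dominant_linear_coeff:
  assumes f: "f = g * h" and deg: "degree f \<le> D" and X: "D < card X"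
    and \<rho>: "1 \<le> v \<theta>" and f1: "coeff f 1 \<noteq> 0"
    and dom: "\<And>k. v (coeff f k) * v \<theta> ^ k \<le> v (coeff f 1) * v \<theta>"
  shows "(\<forall>j\<ge>1. v (coeff g 0 * coeff h j) * v \<theta> \<le> 2 * L ^ (3 * D) * v (coeff f 0)) \<or>
         (\<forall>j\<ge>1. v (coeff g j * coeff h 0) * v \<theta> \<le> 2 * L ^ (3 * D) * v (coeff f 0))"
proof -
  \<comment> \<open>After rescaling the variable by \<theta>, the hypothesis \<open>dom\<close> says
    that the linear coefficient is the largest one, which supplies the bound \<open>M\<close> for
    the product inequality.\<close>
  define s where "s = (\<lambda>p. pcompose p [:0, \<theta>:])"
  have coeff_s: "v (coeff (s p) k) = v (coeff p k) * v \<theta> ^ k" for p k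
    by (simp add: s_def coeff_pcompose_linear mult power)
  have "\<theta> \<noteq> 0"
    using \<rho> by auto
  have s0: "s p \<noteq> 0" if "p \<noteq> 0" for p
  proof -
    have "coeff (s p) (degree p) \<noteq> 0"
      using that \<open>\<theta> \<noteq> 0\<close> by (simp add: s_def coeff_pcompose_linear)
    thus ?thesis by auto
  qed
  have gh0: "g \<noteq> 0" "h \<noteq> 0"
    using f f1 by auto
  have key: "v (coeff g i) * v \<theta> ^ i * (v (coeff h j) * v \<theta> ^ j) \<le> L ^ (3 * D) * (v (coeff f 1) * v \<theta>)" for i j
  proof -
    have *: "s g * s h = s f"
      by (simp add: f s_def pcompose_mult)
    have "degree (s f) \<le> D"
      using deg degree_pcompose_le[of f "[:0, \<theta>:]"] \<open>\<theta> \<noteq> 0\<close> by (simp add: s_def)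
    thus ?thesis
      unfolding coeff_s[symmetric] using dom X
      by (intro coeff_mult_coeff_le s0 gh0) (auto simp: * coeff_s)
  qed
  have small: "v (coeff g' 0 * coeff h' j) * v \<theta> \<le> 2 * L ^ (3 * D) * v (coeff f 0)"
    if large: "v (coeff f 1) \<le> 2 * v (coeff g' 1 * coeff h' 0)" and f': "f = g' * h'"
      and key': "v (coeff g' 1) * v \<theta> ^ 1 * (v (coeff h' j) * v \<theta> ^ j) \<le> L ^ (3 * D) * (v (coeff f 1) * v \<theta>)"
      and j: "1 \<le> j" for g' h' j
  proof -
    have "0 < v (coeff f 1)"
      using f1 by simp
    hence "0 < v (coeff g' 1) * v (coeff h' 0)"
      using large unfolding mult by linarith
    hence pos: "0 < v (coeff g' 1)"
      using zero_less_mult_pos2 nonneg pos_iff by (metis mult_zero_left less_irrefl eq_0_iff)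
    \<comment> \<open>Since the product of \<open>coeff g' 1\<close> and \<open>coeff h' 0\<close>
      has the size of \<open>coeff f 1\<close>, the factor \<open>coeff g' 1\<close> cancels and
      \<open>coeff h' j\<close> is compared with \<open>coeff h' 0\<close>.\<close>
    have "v (coeff g' 1) * v \<theta> * (v (coeff h' j) * v \<theta>) \<le> v (coeff g' 1) * v \<theta> * (v (coeff h' j) * v \<theta> ^ j)"
      using \<rho> j by (intro mult_left_mono self_le_power) auto
    also have "\<dots> \<le> L ^ (3 * D) * (v (coeff f 1) * v \<theta>)"
      using key' by simp
    also have "\<dots> \<le> L ^ (3 * D) * (2 * v (coeff g' 1 * coeff h' 0) * v \<theta>)"
      using L_ge_1 by (intro mult_left_mono mult_right_mono large) auto
    also have "\<dots> = v (coeff g' 1) * v \<theta> * (2 * L ^ (3 * D) * v (coeff h' 0))"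
      by (simp add: mult mult_ac)
    finally have "v (coeff h' j) * v \<theta> \<le> 2 * L ^ (3 * D) * v (coeff h' 0)"
      using pos \<open>\<theta> \<noteq> 0\<close> by (subst (asm) mult_le_cancel_left_pos) auto
    hence "v (coeff g' 0) * (v (coeff h' j) * v \<theta>) \<le> v (coeff g' 0) * (2 * L ^ (3 * D) * v (coeff h' 0))"
      by (intro mult_left_mono) auto
    thus ?thesis
      by (simp add: f' coeff_mult mult mult_ac)
  qed
  \<comment> \<open>One of the two summands carries at least half of the value; this is the origin
    of the factor 2.\<close>
  have "coeff f 1 = coeff g 1 * coeff h 0 + coeff h 1 * coeff g 0"
    by (simp add: f coeff_mult atMost_Suc mult_ac)
  hence "v (coeff f 1) \<le> v (coeff g 1 * coeff h 0) + v (coeff h 1 * coeff g 0)"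
    by (simp add: triangle)
  hence "v (coeff f 1) \<le> 2 * v (coeff g 1 * coeff h 0) \<or> v (coeff f 1) \<le> 2 * v (coeff h 1 * coeff g 0)"
    by linarith
  thus ?thesis
  proof
    assume "v (coeff f 1) \<le> 2 * v (coeff g 1 * coeff h 0)"
    from small[OF this f key] show ?thesis by blast
  next
    assume "v (coeff f 1) \<le> 2 * v (coeff h 1 * coeff g 0)"
    from small[OF this] f key[of _ 1] have "v (coeff h 0 * coeff g j) * v \<theta> \<le> 2 * L ^ (3 * D) * v (coeff f 0)"
      if "1 \<le> j" for j
      using that by (simp add: mult_ac)
    thus ?thesis by (simp add: mult_ac)
  qed
qed

end

section \<open>Domains with the product formula\<close>

lemma le_prod_ge_1:
  fixes f :: "'a \<Rightarrow> real"
  assumes "finite I" "j \<in> I" "\<And>i. i \<in> I \<Longrightarrow> 1 \<le> f i"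
  shows "f j \<le> prod f I"
proof -
  have "f j * 1 \<le> f j * prod f (I - {j})"
    using assms by (intro mult_left_mono prod_ge_1) (auto intro: order.trans[OF zero_le_one])
  thus ?thesis
    using assms by (simp add: prod.remove[of I j])
qed

lemma eventually_le_power:
  fixes x :: real
  assumes "1 < x"
  shows "\<forall>\<^sub>F n in sequentially. B \<le> x ^ n"
proof -
  obtain N where "B < x ^ N"
    using real_arch_pow[OF assms] by blast
  hence "B \<le> x ^ n" if "N \<le> n" for n
    using power_increasing[OF that, of x] assms by linarith
  thus ?thesis
    unfolding eventually_sequentially by blast
qed

locale product_formula_domain =
  fixes S :: "'i set" and v :: "'i \<Rightarrow> 'r::idom \<Rightarrow> real" and \<beta> :: "'i \<Rightarrow> real"
  assumes abs: "P \<in> S \<Longrightarrow> domain_abs (v P)"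
    and \<beta>_pos: "P \<in> S \<Longrightarrow> 0 < \<beta> P"
    and finite_support: "a \<noteq> 0 \<Longrightarrow> finite {P \<in> S. v P a \<noteq> 1}"
    and product_formula: "a \<noteq> 0 \<Longrightarrow> (\<Prod>P | P \<in> S \<and> v P a \<noteq> 1. v P a powr \<beta> P) = 1"
    and nontrivial: "\<exists>P\<in>S. \<exists>a. a \<noteq> 0 \<and> v P a \<noteq> 1"
begin

text \<open>The admissible families of bounds: their weighted product over all primes is finite, and
  they are closed under products.\<close>

definition adelic :: "('i \<Rightarrow> real) \<Rightarrow> bool" where
  "adelic c \<longleftrightarrow> (\<forall>P\<in>S. 1 \<le> c P) \<and> finite {P \<in> S. c P \<noteq> 1}"

lemma adelic_ge_1: "adelic c \<Longrightarrow> P \<in> S \<Longrightarrow> 1 \<le> c P"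
  by (simp add: adelic_def)

lemma adelic_1: "adelic (\<lambda>_. 1)"
  by (simp add: adelic_def)

lemma adelic_mult:
  assumes "adelic c" "adelic d"
  shows "adelic (\<lambda>P. c P * d P)"
  unfolding adelic_def
proof
  show "finite {P \<in> S. c P * d P \<noteq> 1}"
    using assms by (auto simp: adelic_def intro: finite_subset[of _ "{P \<in> S. c P \<noteq> 1} \<union> {P \<in> S. d P \<noteq> 1}"])
qed (use assms in \<open>auto simp: adelic_def intro: one_le_mult\<close>)

lemma adelic_power: "adelic c \<Longrightarrow> adelic (\<lambda>P. c P ^ n)"
  by (induction n) (auto intro: adelic_1 adelic_mult)

lemma adelic_prod: "(\<And>i. i \<in> I \<Longrightarrow> adelic (c i)) \<Longrightarrow> adelic (\<lambda>P. \<Prod>i\<in>I. c i P)"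
  by (induction I rule: infinite_finite_induct) (auto intro: adelic_1 adelic_mult)

lemma adelic_max_abs: "adelic (\<lambda>P. max 1 (v P a))"
proof (cases "a = 0")
  case True
  have "{P \<in> S. max 1 (v P a) \<noteq> 1} = {}"
    using abs by (auto simp: True domain_abs.zero)
  thus ?thesis
    unfolding adelic_def by (metis finite.emptyI max.cobounded1)
next
  case False
  thus ?thesis
    unfolding adelic_def by (auto intro: finite_subset[OF _ finite_support[OF False]])
qed

lemma adelic_max_inverse: "a \<noteq> 0 \<Longrightarrow> adelic (\<lambda>P. max 1 (1 / v P a))"
  unfolding adelic_def by (auto intro!: finite_subset[OF _ finite_support[of a]])

lemma adelic_triangle_const: "adelic (\<lambda>P. domain_abs.triangle_const (v P))"
proof -
  \<comment> \<open>In characteristic 2 the element 2 is zero, a case which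
    \<open>adelic_max_abs\<close> includes.\<close>
  have "{P \<in> S. domain_abs.triangle_const (v P) \<noteq> 1} \<subseteq> {P \<in> S. max 1 (v P 2) \<noteq> 1}"
    by (auto simp: domain_abs.triangle_const_def[OF abs] split: if_splits)
  thus ?thesis
    using adelic_max_abs[of 2] domain_abs.triangle_const_ge_1[OF abs]
    unfolding adelic_def by (blast intro: finite_subset)
qed

lemma prod_abs_eq_1:
  assumes "a \<noteq> 0" "finite U" "U \<subseteq> S" "{P \<in> S. v P a \<noteq> 1} \<subseteq> U"
  shows "(\<Prod>P\<in>U. v P a powr \<beta> P) = 1"
proof -
  have "(\<Prod>P\<in>U. v P a powr \<beta> P) = (\<Prod>P | P \<in> S \<and> v P a \<noteq> 1. v P a powr \<beta> P)"
    using assms by (intro prod.mono_neutral_right) auto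
  thus ?thesis
    using product_formula[OF assms(1)] by simp
qed

text \<open>For nonzero \<open>x\<close>, bounded values outside \<open>T\<close> and tiny values on
  \<open>T\<close> would make the product less than 1. The order of quantifiers matters: \<epsilon>
  depends on \<open>c\<close> and \<open>T\<close> alone.\<close>

lemma eq_0_if_small:
  assumes c: "adelic c" and T: "finite T" "T \<subseteq> S" "T \<noteq> {}"
  shows "\<exists>\<epsilon>>0. \<forall>x. (\<forall>P\<in>S - T. v P x \<le> c P) \<longrightarrow> (\<forall>P\<in>T. v P x \<le> \<epsilon>) \<longrightarrow> x = 0"
proof -
  define C where "C = (\<Prod>P | P \<in> S - T \<and> c P \<noteq> 1. c P powr \<beta> P)"
  have C: "1 \<le> C"
    unfolding C_def using c \<beta>_pos by (intro prod_ge_1 ge_one_powr_ge_zero) (auto simp: adelic_def less_imp_le)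
  obtain P0 where P0: "P0 \<in> T"
    using T by blast
  \<comment> \<open>Chosen so that the single prime \<open>P0\<close> outweighs the total bound
    \<open>C\<close>; the other primes of \<open>T\<close> contribute at most 1.\<close>
  define \<epsilon> where "\<epsilon> = (1 / (2 * C)) powr (1 / \<beta> P0)"
  have b0: "0 < \<beta> P0"
    using P0 T \<beta>_pos by auto
  have \<epsilon>: "0 < \<epsilon>" "\<epsilon> \<le> 1" "\<epsilon> powr \<beta> P0 = 1 / (2 * C)"
    using C b0 by (auto simp: \<epsilon>_def powr_powr intro!: powr_le1)
  have "x = 0" if out: "\<And>P. P \<in> S - T \<Longrightarrow> v P x \<le> c P" and small: "\<And>P. P \<in> T \<Longrightarrow> v P x \<le> \<epsilon>" for x
  proof (rule ccontr)
    assume "x \<noteq> 0"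
    define V where "V = {P \<in> S - T. v P x \<noteq> 1 \<or> c P \<noteq> 1}"
    have "V \<subseteq> {P \<in> S. v P x \<noteq> 1} \<union> {P \<in> S. c P \<noteq> 1}"
      by (auto simp: V_def)
    hence V: "finite V" "V \<inter> T = {}" "V \<subseteq> S"
      using finite_support[OF \<open>x \<noteq> 0\<close>] c by (auto simp: V_def adelic_def intro: finite_subset)
    have "1 = (\<Prod>P\<in>V \<union> T. v P x powr \<beta> P)"
      using T V \<open>x \<noteq> 0\<close> by (intro prod_abs_eq_1 [symmetric]) (auto simp: V_def)
    also have "\<dots> = (\<Prod>P\<in>V. v P x powr \<beta> P) * (\<Prod>P\<in>T. v P x powr \<beta> P)"
      using T V by (intro prod.union_disjoint) auto
    also have "\<dots> \<le> (\<Prod>P\<in>V. c P powr \<beta> P) * (\<Prod>P\<in>T. \<epsilon> powr \<beta> P)"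
      using T out small domain_abs.nonneg[OF abs] \<beta>_pos \<open>V \<subseteq> S\<close>
      by (intro mult_mono prod_mono prod_nonneg conjI powr_mono2) (auto simp: V_def less_imp_le subset_iff)
    also have "(\<Prod>P\<in>V. c P powr \<beta> P) = C"
      unfolding C_def using V by (intro prod.mono_neutral_right) (auto simp: V_def)
    also have "(\<Prod>P\<in>T. \<epsilon> powr \<beta> P) = \<epsilon> powr \<beta> P0 * (\<Prod>P\<in>T - {P0}. \<epsilon> powr \<beta> P)"
      using T P0 by (intro prod.remove) auto
    also have "\<dots> \<le> \<epsilon> powr \<beta> P0 * 1"
      using C \<epsilon> \<beta>_pos T by (intro mult_left_mono prod_le_1 conjI powr_le1) (auto simp: less_imp_le subset_iff)
    also have "C * (\<epsilon> powr \<beta> P0 * 1) < 1"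
      using C by (simp add: \<epsilon>)
    finally show False
      using C by simp
  qed
  thus ?thesis
    using \<epsilon>(1) by blast
qed

text \<open>If no value exceeded 1, an element with some value different from 1 would have product
  less than 1.\<close>

lemma exists_pole: "\<exists>t. \<exists>P\<in>S. 1 < v P t"
proof (rule ccontr)
  assume "\<not> ?thesis"
  hence le_1: "v P t \<le> 1" if "P \<in> S" for P t
    using that by (auto simp: not_less)
  obtain P a where P: "P \<in> S" "a \<noteq> 0" "v P a \<noteq> 1"
    using nontrivial by blast
  let ?U = "{P \<in> S. v P a \<noteq> 1}"
  have nn: "0 \<le> v P' a" if "P' \<in> S" for P'
    using that by (rule domain_abs.nonneg[OF abs])
  have "1 = (\<Prod>P\<in>?U. v P a powr \<beta> P)"
    using finite_support P(2) by (intro prod_abs_eq_1 [symmetric]) auto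
  also have "\<dots> = v P a powr \<beta> P * (\<Prod>P'\<in>?U - {P}. v P' a powr \<beta> P')"
    using finite_support P by (intro prod.remove) auto
  also have "\<dots> \<le> v P a powr \<beta> P * 1"
    using nn \<beta>_pos le_1 by (intro mult_left_mono prod_le_1 conjI powr_le1) (auto simp: less_imp_le)
  also have "\<dots> < 1 powr \<beta> P"
    using P le_1[of P a] nn[of P] \<beta>_pos by (simp, intro powr_less_mono2[of _ _ 1, simplified]) auto
  finally show False by simp
qed

lemma infinite_domain: "infinite (UNIV :: 'r set)"
proof -
  obtain t P where P: "P \<in> S" "1 < v P t"
    using exists_pole by blast
  have "inj (\<lambda>n::nat. t ^ n)"
  proof (rule injI)
    fix m n :: nat assume "t ^ m = t ^ n"
    hence "v P t ^ m = v P t ^ n"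
      by (metis domain_abs.power[OF abs[OF P(1)]])
    thus "m = n"
      using P by (simp add: power_inject_exp)
  qed
  thus ?thesis
    using finite_subset[of "range (\<lambda>n. t ^ n)" UNIV] range_inj_infinite by blast
qed

text \<open>
  Let \<open>f z = H + A z y\<close> with \<open>z = t ^ k + r\<close>, where \<open>k\<close> is large and \<open>r\<close> runs through a finite
  set. At each \<open>P\<close> with \<open>v P t > 1\<close>, the polynomial \<open>f z\<close> has exactly one small root. If
  \<open>f z = g h\<close>, then \<open>e = g\<^sub>1 h\<^sub>0\<close> is close to the linear coefficient of \<open>f z\<close> where this root
  belongs to \<open>g\<close>, and close to \<open>0\<close> where it belongs to \<open>h\<close>. By pigeonhole, two different \<open>r\<close> and
  \<open>r'\<close> lead to the same distribution of the small roots over the factors. Then \<open>\<delta> = e - e'\<close> is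
  close to \<open>\<omega> = A (r - r')\<close> or to \<open>0\<close>, so \<open>\<delta> (\<delta> - \<omega>)\<close> is small at all these \<open>P\<close>, and the product
  formula forces it to vanish. Hence one factor owns no small root at all, and its leading
  coefficient violates the product formula.
\<close>

lemma exists_indecomposable_translate:
  fixes H :: "'r poly"
  assumes H0: "coeff H 0 \<noteq> 0" and A: "A \<noteq> 0" and E: "finite E"
  shows "\<exists>z. z \<notin> E \<and> (\<forall>g h. H + monom (A * z) 1 = g * h \<longrightarrow> degree g = 0 \<or> degree h = 0)"
proof (rule ccontr)
  assume contra: "\<not> ?thesis"
  define f where "f = (\<lambda>z. H + monom (A * z) 1)"
  have f0: "coeff (f z) 0 = coeff H 0" and f1: "coeff (f z) 1 = coeff H 1 + A * z"
    and fk: "k \<noteq> 1 \<Longrightarrow> coeff (f z) k = coeff H k" for z k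
    by (auto simp: f_def)
  have reducible: "\<exists>g h. f z = g * h \<and> 0 < degree g \<and> 0 < degree h" if "z \<notin> E" for z
  proof -
    have "\<not> (\<forall>g h. f z = g * h \<longrightarrow> degree g = 0 \<or> degree h = 0)"
      unfolding f_def using contra that by metis
    thus ?thesis by auto
  qed

  obtain t P0 where P0: "P0 \<in> S" "1 < v P0 t"
    using exists_pole by blast
  have "t \<noteq> 0"
    using P0 domain_abs.zero[OF abs[OF P0(1)]] by auto
  define T where "T = {P \<in> S. 1 < v P t}"
  have T: "finite T" "T \<subseteq> S" "P0 \<in> T"
    using P0 by (auto simp: T_def intro: finite_subset[OF _ finite_support[OF \<open>t \<noteq> 0\<close>]])
  have absT: "domain_abs (v P)" if "P \<in> T" for P
    using that T abs by blast
  define D where "D = max 1 (degree H)"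
  have degf: "degree (f z) \<le> D" for z
    unfolding f_def D_def by (intro degree_add_le) (auto intro: order.trans[OF degree_monom_le])
  obtain Y :: "'r set" where Y: "finite Y" "card Y = Suc D"
    using infinite_arbitrarily_large[OF infinite_domain] by blast
  \<comment> \<open>One more element than \<open>T\<close> has subsets, for the pigeonhole
    argument.\<close>
  obtain R :: "'r set" where R: "finite R" "card R = Suc (2 ^ card T)"
    using infinite_arbitrarily_large[OF infinite_domain] by blast

  \<comment> \<open>Products of terms at least 1 replace maxima, since \<open>adelic\<close> is
    closed under products.\<close>
  define W where "W = (\<lambda>P. \<Prod>y\<in>Y. max 1 (v P y))"
  define Z where "Z = (\<lambda>P. \<Prod>q\<in>{q \<in> Y \<times> Y. fst q \<noteq> snd q}. max 1 (1 / v P (fst q - snd q)))"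
  have WZ: "adelic W" "adelic Z"
    unfolding W_def Z_def by (auto intro!: adelic_prod adelic_max_abs adelic_max_inverse)
  have nodes: "interpolation_nodes (v P) Y (W P) (Z P)" if "P \<in> S" for P
  proof -
    interpret domain_abs "v P"
      using that by (rule abs)
    have "v P y \<le> W P" if "y \<in> Y" for y
    proof -
      have "max 1 (v P y) \<le> W P"
        unfolding W_def using Y that by (intro le_prod_ge_1) auto
      thus ?thesis by simp
    qed
    moreover have "1 \<le> Z P * v P (y - y')" if "y \<in> Y" "y' \<in> Y" "y \<noteq> y'" for y y'
    proof -
      have "max 1 (1 / v P (fst (y, y') - snd (y, y'))) \<le> Z P"
        unfolding Z_def using Y that by (intro le_prod_ge_1) auto
      hence "1 / v P (y - y') \<le> Z P" by simp
      thus ?thesis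
        using that by (simp add: divide_le_eq)
    qed
    ultimately show ?thesis
      using Y(1) WZ that by unfold_locales (auto simp: adelic_ge_1)
  qed
  define \<Gamma> where "\<Gamma> = (\<lambda>P. interpolation_nodes.L (v P) (W P) (Z P) ^ (3 * D))"
  define \<kappa> where "\<kappa> = (\<lambda>P. domain_abs.triangle_const (v P))"
  have \<kappa>: "adelic \<kappa>"
    unfolding \<kappa>_def by (rule adelic_triangle_const)
  have \<Gamma>: "adelic \<Gamma>"
  proof -
    have "adelic (\<lambda>P. ((\<kappa> P)\<^sup>2 * W P * Z P) ^ (3 * D))"
      by (intro adelic_power adelic_mult \<kappa> WZ)
    moreover have "\<Gamma> P = ((\<kappa> P)\<^sup>2 * W P * Z P) ^ (3 * D)" if "P \<in> S" for P
      using interpolation_nodes.L_def[OF nodes[OF that]] by (simp add: \<Gamma>_def \<kappa>_def)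
    ultimately show ?thesis
      by (simp add: adelic_def cong: conj_cong)
  qed

  define mR where "mR = (\<lambda>P. \<Prod>r\<in>R. max 1 (v P r))"
  define mH where "mH = (\<lambda>P. \<Prod>i\<le>degree H. max 1 (v P (coeff H i)))"
  define mA where "mA = (\<lambda>P. max 1 (v P A))"
  define M where "M = (\<lambda>P. \<kappa> P * (mH P * (mA P * (\<kappa> P * mR P))))"
  have m: "adelic mR" "adelic mH" "adelic mA"
    unfolding mR_def mH_def mA_def by (intro adelic_prod adelic_max_abs)+
  have M: "adelic M"
    unfolding M_def by (intro adelic_mult m \<kappa>)
  \<comment> \<open>Outside \<open>T\<close> powers of \<open>t\<close> are at most 1, so
    \<open>M\<close> does not depend on \<open>k\<close>.\<close>
  have coeff_outside: "v P (coeff (f (t ^ k + r)) i) \<le> M P" if P: "P \<in> S - T" and r: "r \<in> R" for P k r i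
  proof -
    have "P \<in> S" using P by simp
    interpret domain_abs "v P"
      using \<open>P \<in> S\<close> by (rule abs)
    note ge_1 = m[THEN adelic_ge_1, OF \<open>P \<in> S\<close>] adelic_ge_1[OF \<kappa> \<open>P \<in> S\<close>]
    have "max 1 (v P r) \<le> mR P"
      unfolding mR_def using R(1) r by (intro le_prod_ge_1) auto
    moreover have "v P (t ^ k) \<le> 1"
      unfolding power using P by (intro power_le_one) (auto simp: T_def)
    ultimately have z: "v P (t ^ k + r) \<le> \<kappa> P * mR P"
      unfolding \<kappa>_def by (intro add_le) auto
    have "max 1 (v P (coeff H i)) \<le> mH P"
    proof (cases "i \<le> degree H")
      case True
      thus ?thesis
        unfolding mH_def by (intro le_prod_ge_1[of _ _ "\<lambda>i. max 1 (v P (coeff H i))"]) auto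
    next
      case False
      thus ?thesis using ge_1 by (simp add: coeff_eq_0)
    qed
    hence Hi: "v P (coeff H i) \<le> mH P" by simp
    define B where "B = mH P * (mA P * (\<kappa> P * mR P))"
    have "mH P * 1 \<le> B"
      unfolding B_def using ge_1 by (intro mult_left_mono one_le_mult) auto
    with Hi have Hi_B: "v P (coeff H i) \<le> B" by simp
    have "v P A * v P (t ^ k + r) \<le> mA P * (\<kappa> P * mR P)"
      using z ge_1 by (intro mult_mono) (auto simp: mA_def)
    also have "\<dots> = 1 * (mA P * (\<kappa> P * mR P))" by simp
    also have "\<dots> \<le> B"
      unfolding B_def using ge_1 by (intro mult_right_mono) auto
    finally have Az: "v P (A * (t ^ k + r)) \<le> B"
      by (simp add: mult)
    have "1 * B \<le> \<kappa> P * B"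
      unfolding B_def using ge_1 by (intro mult_right_mono) auto
    hence "B \<le> M P"
      by (simp add: M_def B_def)
    show ?thesis
    proof (cases "i = 1")
      case True
      thus ?thesis
        using add_le[OF Hi_B Az] unfolding True f1 M_def B_def \<kappa>_def by simp
    next
      case False
      thus ?thesis
        using Hi_B \<open>B \<le> M P\<close> by (simp add: fk)
    qed
  qed
  define c where "c = (\<lambda>P. \<Gamma> P * M P)"
  have c: "adelic c"
    unfolding c_def by (intro adelic_mult \<Gamma> M)
  have factor_outside: "v P (coeff g i * coeff h j) \<le> c P"
    if P: "P \<in> S - T" and r: "r \<in> R" and fz: "f (t ^ k + r) = g * h" for P k r g h i j
  proof -
    have "P \<in> S" using P by simp
    interpret interpolation_nodes "v P" Y "W P" "Z P"
      using \<open>P \<in> S\<close> by (rule nodes)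
    have "coeff (g * h) 0 \<noteq> 0"
      using H0 unfolding fz[symmetric] f0 .
    hence "g \<noteq> 0" "h \<noteq> 0" by auto
    hence "v P (coeff g i) * v P (coeff h j) \<le> L ^ (3 * D) * M P"
      using degf[of "t ^ k + r"] coeff_outside[OF P r, of k] Y
      by (intro coeff_mult_coeff_le) (auto simp: fz)
    thus ?thesis
      by (simp add: mult c_def \<Gamma>_def)
  qed

  define \<Omega> where "\<Omega> = (\<lambda>P. \<Prod>q\<in>R \<times> R. max 1 (v P (A * (fst q - snd q))))"
  \<comment> \<open>The first factor bounds \<delta> outside \<open>T\<close>, the second bounds
    \<delta> - \<omega>, for the differences introduced below.\<close>
  define c' where "c' = (\<lambda>P. (\<kappa> P * c P) * (\<kappa> P * (\<kappa> P * c P * \<Omega> P)))"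
  have \<Omega>: "adelic \<Omega>"
    unfolding \<Omega>_def by (intro adelic_prod adelic_max_abs)
  have c': "adelic c'"
    unfolding c'_def by (intro adelic_mult \<kappa> c \<Omega>)
  obtain \<epsilon> where \<epsilon>: "0 < \<epsilon>"
    and eq_0: "\<And>x. (\<And>P. P \<in> S - T \<Longrightarrow> v P x \<le> c' P) \<Longrightarrow> (\<And>P. P \<in> T \<Longrightarrow> v P x \<le> \<epsilon>) \<Longrightarrow> x = 0"
    using eq_0_if_small[OF c' T(1,2)] T(3) by blast
  \<comment> \<open>The first condition will make \<delta> (\<delta> - \<omega>) small on
    \<open>T\<close>; the second keeps a nonzero \<omega> farther than 2 \<eta> from 0.\<close>
  have "\<forall>\<^sub>F \<eta> in at_right 0. \<forall>P\<in>T. \<forall>q\<in>R \<times> R. 2 * \<eta> * (v P (A * (fst q - snd q)) + 2 * \<eta>) < \<epsilon> \<and>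
      (A * (fst q - snd q) \<noteq> 0 \<longrightarrow> 2 * \<eta> < v P (A * (fst q - snd q)))"
  proof (intro eventually_ball_finite ballI eventually_conj)
    fix P q assume "P \<in> T"
    let ?\<omega> = "A * (fst q - snd q)"
    have "((\<lambda>\<eta>. 2 * \<eta> * (v P ?\<omega> + 2 * \<eta>)) \<longlongrightarrow> 2 * 0 * (v P ?\<omega> + 2 * 0)) (at_right 0)"
      by (intro tendsto_intros)
    thus "\<forall>\<^sub>F \<eta> in at_right 0. 2 * \<eta> * (v P ?\<omega> + 2 * \<eta>) < \<epsilon>"
      using \<epsilon> by (auto intro: order_tendstoD)
    have lim: "((\<lambda>\<eta>::real. 2 * \<eta>) \<longlongrightarrow> 2 * 0) (at_right 0)"
      by (intro tendsto_intros)
    show "\<forall>\<^sub>F \<eta> in at_right 0. ?\<omega> \<noteq> 0 \<longrightarrow> 2 * \<eta> < v P ?\<omega>"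
    proof (cases "?\<omega> = 0")
      case False
      hence "2 * 0 < v P ?\<omega>"
        using domain_abs.pos_iff[OF absT[OF \<open>P \<in> T\<close>]] by simp
      thus ?thesis
        using order_tendstoD(2)[OF lim] by (auto elim: eventually_mono)
    qed simp
  qed (use T R in auto)
  moreover have "\<forall>\<^sub>F \<eta> in at_right 0. \<eta> < \<epsilon>"
    using \<epsilon> by (simp add: eventually_at_right_real eventually_at_right_field) blast
  ultimately have "\<forall>\<^sub>F \<eta> in at_right 0. 0 < \<eta> \<and> \<eta> < \<epsilon> \<and> (\<forall>P\<in>T. \<forall>q\<in>R \<times> R.
      2 * \<eta> * (v P (A * (fst q - snd q)) + 2 * \<eta>) < \<epsilon> \<and>
      (A * (fst q - snd q) \<noteq> 0 \<longrightarrow> 2 * \<eta> < v P (A * (fst q - snd q))))"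
    by (intro eventually_conj eventually_at_right_less)
  then obtain \<eta> where \<eta>: "0 < \<eta>" "\<eta> < \<epsilon>"
    and \<eta>_mult: "\<And>P r r'. P \<in> T \<Longrightarrow> r \<in> R \<Longrightarrow> r' \<in> R \<Longrightarrow> 2 * \<eta> * (v P (A * (r - r')) + 2 * \<eta>) < \<epsilon>"
    and \<eta>_less: "\<And>P r r'. P \<in> T \<Longrightarrow> r \<in> R \<Longrightarrow> r' \<in> R \<Longrightarrow> A * (r - r') \<noteq> 0 \<Longrightarrow> 2 * \<eta> < v P (A * (r - r'))"
    using eventually_happens[of _ "at_right (0::real)"] trivial_limit_at_right_real by fastforce

  \<comment> \<open>The scaling element will be \<open>t ^ l\<close>: the bound of
    \<open>dominant_linear_coeff\<close> then drops to \<eta>.\<close>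
  have "\<forall>\<^sub>F l in sequentially. \<forall>P\<in>T. 2 * \<Gamma> P * v P (coeff H 0) / \<eta> \<le> v P t ^ l"
    using T by (intro eventually_ball_finite ballI eventually_le_power) (auto simp: T_def)
  then obtain l where l: "\<And>P. P \<in> T \<Longrightarrow> 2 * \<Gamma> P * v P (coeff H 0) \<le> \<eta> * v P t ^ l"
    using \<eta> by (auto simp: eventually_sequentially field_simps)
  define B where "B = (\<lambda>P. \<Sum>i\<le>D. v P (coeff H i) * (v P t ^ l) ^ i)"
  \<comment> \<open>Only after \<open>l\<close> is fixed is \<open>k\<close> chosen, so that the
    linear coefficient exceeds all rescaled coefficients of \<open>H\<close>. The condition at
    \<open>P0\<close> makes \<open>t ^ k + r\<close> larger than every element of
    \<open>E\<close>.\<close>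
  have "\<forall>\<^sub>F k in sequentially. (\<forall>P\<in>T. \<forall>r\<in>R. (B P + 1 + v P (coeff H 1 + A * r)) / v P A \<le> v P t ^ k) \<and>
      (\<forall>r\<in>R. \<forall>x\<in>E. v P0 x + v P0 r + 1 \<le> v P0 t ^ k)"
    using T R E P0 by (intro eventually_conj eventually_ball_finite ballI eventually_le_power) (auto simp: T_def)
  from eventually_happens'[OF sequentially_bot this] obtain k where
    k: "\<And>P r. P \<in> T \<Longrightarrow> r \<in> R \<Longrightarrow> (B P + 1 + v P (coeff H 1 + A * r)) / v P A \<le> v P t ^ k"
    and kE: "\<And>r x. r \<in> R \<Longrightarrow> x \<in> E \<Longrightarrow> v P0 x + v P0 r + 1 \<le> v P0 t ^ k"
    by blast
  have "t ^ k + r \<notin> E" if "r \<in> R" for r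
  proof
    interpret domain_abs "v P0"
      using P0(1) by (rule abs)
    assume "t ^ k + r \<in> E"
    from kE[OF that this] diff_ge[of "t ^ k" r] show False
      by (simp add: power)
  qed
  hence "\<forall>r\<in>R. \<exists>gh. f (t ^ k + r) = fst gh * snd gh \<and> 0 < degree (fst gh) \<and> 0 < degree (snd gh)"
    using reducible by fastforce
  from bchoice[OF this] obtain gh where
    gh: "\<forall>r\<in>R. f (t ^ k + r) = fst (gh r) * snd (gh r) \<and> 0 < degree (fst (gh r)) \<and> 0 < degree (snd (gh r))" ..
  define g where "g = (\<lambda>r. fst (gh r))"
  define h where "h = (\<lambda>r. snd (gh r))"
  have fgh: "f (t ^ k + r) = g r * h r" and deg_pos: "0 < degree (g r)" "0 < degree (h r)" if "r \<in> R" for r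
    using gh that by (auto simp: g_def h_def)

  have small: "(\<forall>j\<ge>1. v P (coeff (g r) 0 * coeff (h r) j) \<le> \<eta>) \<or> (\<forall>j\<ge>1. v P (coeff (g r) j * coeff (h r) 0) \<le> \<eta>)"
    if P: "P \<in> T" and r: "r \<in> R" for P r
  proof -
    have "P \<in> S" using P T by auto
    interpret interpolation_nodes "v P" Y "W P" "Z P"
      using \<open>P \<in> S\<close> by (rule nodes)
    define \<rho> where "\<rho> = v P t ^ l"
    have \<rho>: "1 \<le> \<rho>"
      unfolding \<rho>_def using P by (intro one_le_power) (auto simp: T_def)
    have vA: "0 < v P A"
      using A by simp
    have "B P + 1 \<le> v P A * v P t ^ k - v P (coeff H 1 + A * r)"
      using k[OF P r] vA by (simp add: divide_le_eq mult.commute)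
    also have "\<dots> \<le> v P (A * t ^ k + (coeff H 1 + A * r))"
      using diff_ge[of "A * t ^ k" "coeff H 1 + A * r"] by (simp add: mult power)
    also have "A * t ^ k + (coeff H 1 + A * r) = coeff (f (t ^ k + r)) 1"
      unfolding f1 by (simp add: algebra_simps)
    finally have large: "B P + 1 \<le> v P (coeff (f (t ^ k + r)) 1)" .
    have B0: "0 \<le> B P"
      unfolding B_def by (intro sum_nonneg mult_nonneg_nonneg) auto
    have dom: "v P (coeff (f (t ^ k + r)) i) * \<rho> ^ i \<le> v P (coeff (f (t ^ k + r)) 1) * \<rho>" for i
    proof (cases "i = 1")
      case False
      have "v P (coeff H i) * \<rho> ^ i \<le> B P"
      proof (cases "i \<le> D")
        case True
        thus ?thesis
          unfolding B_def \<rho>_def by (intro member_le_sum) auto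
      next
        case False
        hence "coeff H i = 0"
          by (intro coeff_eq_0) (auto simp: D_def)
        thus ?thesis using B0 by simp
      qed
      also have "\<dots> \<le> v P (coeff (f (t ^ k + r)) 1) * 1"
        using large by simp
      also have "\<dots> \<le> v P (coeff (f (t ^ k + r)) 1) * \<rho>"
        using \<rho> by (intro mult_left_mono) auto
      finally show ?thesis
        using False by (simp add: fk)
    qed simp
    have "(\<forall>j\<ge>1. v P (coeff (g r) 0 * coeff (h r) j) * v P (t ^ l) \<le> 2 * L ^ (3 * D) * v P (coeff (f (t ^ k + r)) 0)) \<or>
          (\<forall>j\<ge>1. v P (coeff (g r) j * coeff (h r) 0) * v P (t ^ l) \<le> 2 * L ^ (3 * D) * v P (coeff (f (t ^ k + r)) 0))"
    proof (rule dominant_linear_coeff[OF fgh[OF r] degf])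
      show "coeff (f (t ^ k + r)) 1 \<noteq> 0"
        using large B0 by (metis add_nonneg_pos less_le_not_le zero zero_less_one)
    qed (use Y \<rho> dom in \<open>auto simp: power \<rho>_def\<close>)
    moreover have "2 * L ^ (3 * D) * v P (coeff (f (t ^ k + r)) 0) \<le> \<eta> * v P (t ^ l)"
      using l[OF P] unfolding f0 by (simp add: \<Gamma>_def power)
    moreover have "0 < v P (t ^ l)"
      using \<open>t \<noteq> 0\<close> by simp
    ultimately show ?thesis
      by (meson mult_le_cancel_right_pos order.trans)
  qed

  \<comment> \<open>Where both alternatives of \<open>small\<close> hold, the prime is put into
    \<tau>; off \<tau> the second alternative is guaranteed.\<close>
  define \<tau> where "\<tau> = (\<lambda>r. {P \<in> T. \<forall>j\<ge>1. v P (coeff (g r) 0 * coeff (h r) j) \<le> \<eta>})"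
  have "card (\<tau> ` R) \<le> card (Pow T)"
    using T by (intro card_mono) (auto simp: \<tau>_def)
  also have "\<dots> < card R"
    using R T by (simp add: card_Pow)
  finally have "\<not> inj_on \<tau> R"
    by (rule pigeonhole)
  then obtain r r' where r: "r \<in> R" "r' \<in> R" "r \<noteq> r'" and \<tau>: "\<tau> r = \<tau> r'"
    by (auto simp: inj_on_def)

  \<comment> \<open>The linear coefficients of the translates grow with \<open>k\<close>, but their
    difference \<omega> does not involve \<open>k\<close>; hence two translates are
    compared.\<close>
  define e where "e = (\<lambda>r. coeff (g r) 1 * coeff (h r) 0)"
  define \<omega> where "\<omega> = A * (r - r')"
  define \<delta> where "\<delta> = e r - e r'"
  have "\<omega> \<noteq> 0"
    using A r by (simp add: \<omega>_def)
  have e': "coeff (f (t ^ k + s)) 1 - e s = coeff (g s) 0 * coeff (h s) 1" if "s \<in> R" for s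
    unfolding fgh[OF that] by (simp add: e_def coeff_mult atMost_Suc)
  have \<omega>: "coeff (f (t ^ k + r)) 1 - coeff (f (t ^ k + r')) 1 = \<omega>"
    unfolding f1 by (simp add: \<omega>_def algebra_simps)
  have near_\<omega>: "v P (\<delta> - \<omega>) \<le> 2 * \<eta>" if "P \<in> \<tau> r" for P
  proof -
    have "P \<in> T" "P \<in> \<tau> r'"
      using that \<tau> by (auto simp: \<tau>_def)
    interpret domain_abs "v P"
      using \<open>P \<in> T\<close> by (rule absT)
    have "\<delta> - \<omega> = coeff (g r') 0 * coeff (h r') 1 - coeff (g r) 0 * coeff (h r) 1"
      unfolding \<delta>_def \<omega>[symmetric] e'[OF r(1), symmetric] e'[OF r(2), symmetric] by simp
    moreover have "v P (coeff (g r') 0 * coeff (h r') 1) \<le> \<eta>" "v P (coeff (g r) 0 * coeff (h r) 1) \<le> \<eta>"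
      using that \<open>P \<in> \<tau> r'\<close> unfolding \<tau>_def by blast+
    ultimately show ?thesis
      using triangle_diff[of "coeff (g r') 0 * coeff (h r') 1" "coeff (g r) 0 * coeff (h r) 1"] by simp
  qed
  have small_h: "v P (coeff (g s) j * coeff (h s) 0) \<le> \<eta>" if "P \<in> T - \<tau> s" "s \<in> R" "1 \<le> j" for P s j
    using small[of P s] that unfolding \<tau>_def by blast
  have near_0: "v P \<delta> \<le> 2 * \<eta>" if "P \<in> T - \<tau> r" for P
  proof -
    interpret domain_abs "v P"
      using that absT by blast
    have "v P (e r) \<le> \<eta>" "v P (e r') \<le> \<eta>"
      using small_h that r \<tau> by (auto simp: e_def)
    thus ?thesis
      using triangle_diff[of "e r" "e r'"] by (simp add: \<delta>_def)
  qed

  have "\<delta> * (\<delta> - \<omega>) = 0"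
  proof (rule eq_0)
    fix P assume P: "P \<in> S - T"
    hence "P \<in> S" by simp
    interpret domain_abs "v P"
      using \<open>P \<in> S\<close> by (rule abs)
    note ge_1 = \<kappa>[THEN adelic_ge_1, OF \<open>P \<in> S\<close>] c[THEN adelic_ge_1, OF \<open>P \<in> S\<close>] \<Omega>[THEN adelic_ge_1, OF \<open>P \<in> S\<close>]
    have \<delta>: "v P \<delta> \<le> \<kappa> P * c P"
      unfolding \<delta>_def e_def \<kappa>_def using factor_outside[OF P _ fgh] r by (intro diff_le) auto
    have "max 1 (v P (A * (fst (r, r') - snd (r, r')))) \<le> \<Omega> P"
      unfolding \<Omega>_def using R(1) r by (intro le_prod_ge_1) auto
    hence "1 * v P \<omega> \<le> \<kappa> P * c P * \<Omega> P"
      using ge_1 by (intro mult_mono one_le_mult) (auto simp: \<omega>_def)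
    moreover have "\<kappa> P * c P * 1 \<le> \<kappa> P * c P * \<Omega> P"
      using ge_1 by (intro mult_left_mono) auto
    ultimately have "v P (\<delta> - \<omega>) \<le> \<kappa> P * (\<kappa> P * c P * \<Omega> P)"
      using \<delta> unfolding \<kappa>_def by (intro diff_le) auto
    with \<delta> show "v P (\<delta> * (\<delta> - \<omega>)) \<le> c' P"
      unfolding mult c'_def using ge_1 by (intro mult_mono) auto
  next
    fix P assume P: "P \<in> T"
    interpret domain_abs "v P"
      using P by (rule absT)
    have "v P \<delta> * v P (\<delta> - \<omega>) \<le> 2 * \<eta> * (v P \<omega> + 2 * \<eta>)"
    proof (cases "P \<in> \<tau> r")
      case True
      from near_\<omega>[OF this] triangle[of "\<delta> - \<omega>" \<omega>] have "v P \<delta> \<le> v P \<omega> + 2 * \<eta>"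
        by simp
      hence "v P (\<delta> - \<omega>) * v P \<delta> \<le> 2 * \<eta> * (v P \<omega> + 2 * \<eta>)"
        using near_\<omega>[OF True] \<eta> by (intro mult_mono) auto
      thus ?thesis by (simp add: mult.commute)
    next
      case False
      hence "v P \<delta> \<le> 2 * \<eta>"
        using near_0 P by simp
      moreover from this triangle_diff[of \<delta> \<omega>] have "v P (\<delta> - \<omega>) \<le> v P \<omega> + 2 * \<eta>"
        by simp
      ultimately show ?thesis
        using \<eta> by (intro mult_mono) auto
    qed
    also have "\<dots> < \<epsilon>"
      unfolding \<omega>_def using P r by (intro \<eta>_mult)
    finally show "v P (\<delta> * (\<delta> - \<omega>)) \<le> \<epsilon>"
      by (simp add: mult)
  qed
  hence "\<delta> = 0 \<or> \<delta> = \<omega>"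
    by simp
  \<comment> \<open>At a prime of \<tau>, \<delta> = 0 would put \<omega> within 2 \<eta> of 0,
    against the choice of \<eta>; \<delta> = \<omega> does the same off \<tau>.\<close>
  moreover have "\<tau> r = {}" if "\<delta> = 0"
  proof (rule equals0I)
    fix P assume P: "P \<in> \<tau> r"
    hence "P \<in> T" by (simp add: \<tau>_def)
    from near_\<omega>[OF P] \<eta>_less[OF this r(1,2)] \<open>\<omega> \<noteq> 0\<close> that show False
      using domain_abs.minus[OF absT[OF \<open>P \<in> T\<close>], of \<omega>] by (simp add: \<omega>_def)
  qed
  moreover have "\<tau> r = T" if "\<delta> = \<omega>"
  proof (rule ccontr)
    assume "\<tau> r \<noteq> T"
    then obtain P where "P \<in> T - \<tau> r"
      by (auto simp: \<tau>_def)
    with near_0[OF this] \<eta>_less[of P r r'] \<open>\<omega> \<noteq> 0\<close> that r show False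
      by (simp add: \<omega>_def)
  qed
  ultimately have uniform: "\<tau> r = {} \<or> \<tau> r = T" by blast

  have gh0: "coeff (g r) 0 \<noteq> 0" "coeff (h r) 0 \<noteq> 0"
    using H0 f0[of "t ^ k + r"] unfolding fgh[OF r(1)] by (auto simp: coeff_mult)
  \<comment> \<open>Thus the same \<epsilon> also applies to single products of coefficients of the
    factors.\<close>
  have "c P \<le> c' P" if "P \<in> S" for P
  proof -
    note ge_1 = \<kappa>[THEN adelic_ge_1, OF that] c[THEN adelic_ge_1, OF that] \<Omega>[THEN adelic_ge_1, OF that]
    have "1 * c P * 1 \<le> \<kappa> P * c P * (\<kappa> P * (\<kappa> P * c P * \<Omega> P))"
      using ge_1 by (intro mult_mono mult_right_mono one_le_mult) auto
    thus ?thesis by (simp add: c'_def)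
  qed
  hence outside: "v P (coeff (g r) i * coeff (h r) j) \<le> c' P" if "P \<in> S - T" for P i j
    using factor_outside[OF that r(1) fgh[OF r(1)], of i j] that by fastforce
  from uniform show False
  proof
    assume "\<tau> r = {}"
    hence "coeff (g r) (degree (g r)) * coeff (h r) 0 = 0"
      using deg_pos[OF r(1)] r(1) \<eta> by (intro eq_0 outside order.trans[OF small_h]) auto
    thus False
      using gh0 deg_pos[OF r(1)] by auto
  next
    assume "\<tau> r = T"
    hence "v P (coeff (g r) 0 * coeff (h r) (degree (h r))) \<le> \<epsilon>" if "P \<in> T" for P
    proof -
      have "P \<in> \<tau> r"
        using that \<open>\<tau> r = T\<close> by simp
      hence "v P (coeff (g r) 0 * coeff (h r) (degree (h r))) \<le> \<eta>"
        using deg_pos(2)[OF r(1)] by (simp add: \<tau>_def)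
      thus ?thesis
        using \<eta> by simp
    qed
    hence "coeff (g r) 0 * coeff (h r) (degree (h r)) = 0"
      by (intro eq_0 outside)
    thus False
      using gh0 deg_pos[OF r(1)] by auto
  qed
qed

end

section \<open>Restriction of polynomials to lines\<close>

lemma monom_degree_add: "monom_degree (m + k) = monom_degree m + monom_degree k"
  by (simp add: monom_degree_def lookup_add sum.distrib)

lemma monom_degree_eq_0_iff: "monom_degree m = 0 \<longleftrightarrow> m = 0"
  by (auto simp: monom_degree_def poly_mapping_eq_iff fun_eq_iff)

lemma monom_degree_single [simp]: "monom_degree (Poly_Mapping.single i k) = k"
  by (simp add: monom_degree_def lookup_single when_def)

lemma lookup_le_monom_degree: "Poly_Mapping.lookup m i \<le> monom_degree m"
  unfolding monom_degree_def by (rule member_le_sum) auto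

lemma total_degree_le_iff: "total_degree p \<le> n \<longleftrightarrow> (\<forall>m\<in>Poly_Mapping.keys p. monom_degree m \<le> n)"
  by (auto simp: total_degree_def)

lemma monom_degree_le_total_degree: "m \<in> Poly_Mapping.keys p \<Longrightarrow> monom_degree m \<le> total_degree p"
  using total_degree_le_iff by blast

lemma exists_key_total_degree:
  assumes "p \<noteq> 0"
  shows "\<exists>m\<in>Poly_Mapping.keys p. monom_degree m = total_degree p"
proof -
  have ne: "Poly_Mapping.keys p \<noteq> {}"
    using assms by (auto simp: poly_mapping_eq_iff fun_eq_iff in_keys_iff)
  have "total_degree p = Max (monom_degree ` Poly_Mapping.keys p)"
    unfolding total_degree_def using ne by (subst Max_insert) auto
  moreover have "Max (monom_degree ` Poly_Mapping.keys p) \<in> monom_degree ` Poly_Mapping.keys p"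
    using ne by (intro Max_in) auto
  ultimately show ?thesis by auto
qed

lemma total_degree_eq_0_iff: "total_degree p = 0 \<longleftrightarrow> (\<exists>c. p = mpoly_const c)"
proof
  assume "total_degree p = 0"
  hence "\<forall>m\<in>Poly_Mapping.keys p. m = 0"
    using total_degree_le_iff[of p 0] by (auto simp: monom_degree_eq_0_iff)
  hence "p = mpoly_const (Poly_Mapping.lookup p 0)"
    by (intro poly_mapping_eqI) (auto simp: lookup_single when_def in_keys_iff)
  thus "\<exists>c. p = mpoly_const c" ..
qed (auto simp: total_degree_def monom_degree_eq_0_iff)

section \<open>Substitution along a line through the origin\<close>

definition monom_eval :: "('n::finite \<Rightarrow> 'r) \<Rightarrow> ('n \<Rightarrow>\<^sub>0 nat) \<Rightarrow> 'r::comm_semiring_1" where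
  "monom_eval u m = (\<Prod>i\<in>UNIV. u i ^ Poly_Mapping.lookup m i)"

lemma monom_eval_add: "monom_eval u (m + k) = monom_eval u m * monom_eval u k"
  by (simp add: monom_eval_def lookup_add power_add prod.distrib)

lemma monom_eval_0 [simp]: "monom_eval u 0 = 1"
  by (simp add: monom_eval_def)

lemma monom_eval_single [simp]: "monom_eval u (Poly_Mapping.single i k) = u i ^ k"
proof -
  have "monom_eval u (Poly_Mapping.single i k) = (\<Prod>j\<in>UNIV. if i = j then u j ^ k else 1)"
    unfolding monom_eval_def by (intro prod.cong) (auto simp: lookup_single when_def)
  thus ?thesis by simp
qed

text \<open>The ring homomorphism sending the variable with index \<open>i\<close> to
  \<open>u i\<close> times one new variable; its coefficient at \<open>k\<close> is the homogeneous
  part of degree \<open>k\<close> evaluated at \<open>u\<close>.\<close>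

definition on_line :: "('n::finite \<Rightarrow> 'r) \<Rightarrow> ('n, 'r::comm_ring_1) mpoly \<Rightarrow> 'r poly" where
  "on_line u p = (\<Sum>m\<in>Poly_Mapping.keys p. monom (Poly_Mapping.lookup p m * monom_eval u m) (monom_degree m))"

lemma on_line_add: "on_line u (p + q) = on_line u p + on_line u q"
  unfolding on_line_def
  by (rule setsum_keys_plus_distrib) (auto simp: distrib_right add_monom)

lemma on_line_0 [simp]: "on_line u 0 = 0"
  by (simp add: on_line_def)

lemma on_line_term [simp]: "on_line u (mpoly_term c m) = monom (c * monom_eval u m) (monom_degree m)"
  by (cases "c = 0") (auto simp: on_line_def)

lemma mpoly_induct [case_names zero add_term]:
  fixes p :: "('n::finite, 'r::comm_ring_1) mpoly"
  assumes "P 0" and "\<And>p c m. P p \<Longrightarrow> P (p + mpoly_term c m)"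
  shows "P p"
proof (induction p rule: update_induct)
  case (update p m c)
  have "Poly_Mapping.update m c p = p + mpoly_term c m"
    using update(1) by (intro poly_mapping_eqI) (auto simp: lookup_update lookup_add lookup_single when_def in_keys_iff)
  thus ?case using assms(2) update by simp
qed (fact assms(1))

lemma on_line_mult: "on_line u (p * q) = on_line u p * on_line u q"
proof (induction p rule: mpoly_induct)
  case (add_term p c m)
  have "on_line u (mpoly_term c m * q) = on_line u (mpoly_term c m) * on_line u q"
  proof (induction q rule: mpoly_induct)
    case (add_term q d k)
    thus ?case
      by (simp add: distrib_left on_line_add mult_single mult_monom monom_eval_add monom_degree_add mult_ac add_ac)
  qed simp
  with add_term show ?case
    by (simp add: distrib_right on_line_add)
qed simp

lemma degree_on_line_le: "degree (on_line u p) \<le> total_degree p"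
  unfolding on_line_def
  by (intro degree_sum_le) (auto intro: order.trans[OF degree_monom_le] monom_degree_le_total_degree)

lemma coeff_on_line:
  "coeff (on_line u p) k = (\<Sum>m | m \<in> Poly_Mapping.keys p \<and> monom_degree m = k. Poly_Mapping.lookup p m * monom_eval u m)"
proof -
  have "coeff (on_line u p) k =
      (\<Sum>m\<in>Poly_Mapping.keys p. if monom_degree m = k then Poly_Mapping.lookup p m * monom_eval u m else 0)"
    by (simp add: on_line_def coeff_sum)
  also have "\<dots> = (\<Sum>m | m \<in> Poly_Mapping.keys p \<and> monom_degree m = k. Poly_Mapping.lookup p m * monom_eval u m)"
    by (simp add: sum.If_cases Int_def)
  finally show ?thesis .
qed

lemma coeff_on_line_0: "coeff (on_line u p) 0 = Poly_Mapping.lookup p 0"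
proof -
  have "{m \<in> Poly_Mapping.keys p. monom_degree m = 0} = Poly_Mapping.keys p \<inter> {0}"
    by (auto simp: monom_degree_eq_0_iff)
  hence "coeff (on_line u p) 0 = (\<Sum>m\<in>Poly_Mapping.keys p \<inter> {0}. Poly_Mapping.lookup p m * monom_eval u m)"
    by (simp only: coeff_on_line)
  thus ?thesis
    by (cases "0 \<in> Poly_Mapping.keys p") (simp_all add: not_in_keys_iff_lookup_eq_zero)
qed

lemma digits_unique:
  fixes a b :: "nat \<Rightarrow> nat"
  assumes "\<And>j. a j < N" "\<And>j. b j < N" "(\<Sum>j<n. a j * N ^ j) = (\<Sum>j<n. b j * N ^ j)" "j < n"
  shows "a j = b j"
  using assms
proof (induction n arbitrary: a b j)
  case (Suc n)
  have expand: "(\<Sum>j<Suc n. c j * N ^ j) = c 0 + N * (\<Sum>j<n. c (Suc j) * N ^ j)" for c :: "nat \<Rightarrow> nat"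
    by (simp add: sum.lessThan_Suc_shift sum_distrib_left mult_ac del: sum.lessThan_Suc)
  have eq: "a 0 + N * (\<Sum>j<n. a (Suc j) * N ^ j) = b 0 + N * (\<Sum>j<n. b (Suc j) * N ^ j)"
    using Suc.prems(3) by (simp only: expand)
  have "a 0 = b 0"
    using arg_cong[OF eq, of "\<lambda>x. x mod N"] Suc.prems(1,2) by simp
  moreover have "N > 0"
    using Suc.prems(1)[of 0] by simp
  ultimately have "(\<Sum>j<n. a (Suc j) * N ^ j) = (\<Sum>j<n. b (Suc j) * N ^ j)"
    using eq by simp
  hence "a (Suc i) = b (Suc i)" if "i < n" for i
    using Suc.IH[of "\<lambda>j. a (Suc j)" "\<lambda>j. b (Suc j)" i] Suc.prems(1,2) that by auto
  with \<open>a 0 = b 0\<close> Suc.prems(4) show ?case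
    by (cases j) auto
qed simp

text \<open>Kronecker substitution: the line has direction \<open>u i = s ^ (N ^ i)\<close>.\<close>

lemma exists_line:
  fixes F :: "('n::finite, 'r::idom) mpoly set"
  assumes inf: "infinite (UNIV :: 'r set)" and F: "finite F" "0 \<notin> F"
  shows "\<exists>u. (\<forall>i. u i \<noteq> 0) \<and> (\<forall>p\<in>F. coeff (on_line u p) (total_degree p) \<noteq> 0)"
proof -
  obtain e :: "'n \<Rightarrow> nat" and n where e: "bij_betw e UNIV {..<n}"
    using ex_bij_betw_finite_nat[of "UNIV :: 'n set"] by (auto simp: atLeast0LessThan)
  define N where "N = Suc (Max (insert 0 (total_degree ` F)))"
  have N: "total_degree p < N" if "p \<in> F" for p
    using F that by (auto simp: N_def less_Suc_eq_le)
  define w where "w = (\<lambda>m. \<Sum>i\<in>UNIV. Poly_Mapping.lookup m i * N ^ e i)"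
  have w_inj: "m = k" if "w m = w k" "monom_degree m < N" "monom_degree k < N" for m k :: "'n \<Rightarrow>\<^sub>0 nat"
  proof -
    define d where "d = (\<lambda>(m :: 'n \<Rightarrow>\<^sub>0 nat) j. Poly_Mapping.lookup m (inv_into UNIV e j))"
    have w: "w m = (\<Sum>j<n. d m j * N ^ j)" for m
      unfolding w_def d_def
      by (subst sum.reindex_bij_betw[OF e, symmetric]) (use e in \<open>auto simp: bij_betw_def\<close>)
    have "d m j = d k j" if "j < n" for j
      using digits_unique[of "d m" N "d k" n j] that \<open>w m = w k\<close> lookup_le_monom_degree
        \<open>monom_degree m < N\<close> \<open>monom_degree k < N\<close> by (auto simp: w d_def intro: le_less_trans)
    moreover have "inv_into UNIV e (e i) = i" "e i < n" for i
      using e by (auto simp: bij_betw_def)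
    ultimately show ?thesis
      by (intro poly_mapping_eqI) (metis d_def)
  qed
  define top where "top = (\<lambda>p :: ('n, 'r) mpoly. {m \<in> Poly_Mapping.keys p. monom_degree m = total_degree p})"
  \<comment> \<open>The top homogeneous part on the Kronecker direction, as a polynomial in
    \<open>s\<close>; distinct monomials receive distinct exponents \<open>w m\<close>, so nothing
    cancels.\<close>
  define K where "K = (\<lambda>p. \<Sum>m\<in>top p. monom (Poly_Mapping.lookup p m) (w m))"
  have K0: "K p \<noteq> 0" if "p \<in> F" for p
  proof -
    have "p \<noteq> 0"
      using F that by auto
    then obtain m where m: "m \<in> top p"
      using exists_key_total_degree[of p] by (auto simp: top_def)
    have "coeff (K p) (w m) = (\<Sum>k\<in>top p. if k = m then Poly_Mapping.lookup p k else 0)"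
      unfolding K_def coeff_sum
      using w_inj[of _ m] m N[OF that] by (intro sum.cong) (auto simp: top_def)
    also have "\<dots> = Poly_Mapping.lookup p m"
      using m by (simp add: top_def)
    finally show ?thesis
      using m by (auto simp: top_def in_keys_iff)
  qed
  \<comment> \<open>The linear factor forces \<open>s\<close> to be nonzero, hence all
    \<open>u i\<close> as well.\<close>
  define P where "P = [:0, 1:] * prod K F"
  have "P \<noteq> 0"
    using K0 F by (auto simp: P_def)
  then obtain s where "poly P s \<noteq> 0"
    using inf poly_roots_finite[of P] by (metis (mono_tags, lifting) UNIV_I ex_new_if_finite mem_Collect_eq)
  hence s: "s \<noteq> 0" "\<And>p. p \<in> F \<Longrightarrow> poly (K p) s \<noteq> 0"
    using F by (auto simp: P_def poly_prod)
  define u where "u = (\<lambda>i. s ^ (N ^ e i))"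
  have ev: "monom_eval u m = s ^ w m" for m
    by (simp add: monom_eval_def u_def w_def power_sum mult.commute flip: power_mult)
  have "coeff (on_line u p) (total_degree p) \<noteq> 0" if "p \<in> F" for p
  proof -
    have "coeff (on_line u p) (total_degree p) = poly (K p) s"
      by (simp add: coeff_on_line K_def top_def ev poly_sum poly_monom)
    thus ?thesis
      using s that by simp
  qed
  moreover have "u i \<noteq> 0" for i
    using s by (simp add: u_def)
  ultimately show ?thesis by blast
qed

text \<open>On a line that preserves the total degrees of both factors, degrees of univariate
  polynomials add.\<close>

lemma total_degree_mult_ge:
  fixes p q :: "('n::finite, 'r::idom) mpoly"
  assumes "infinite (UNIV :: 'r set)" "p \<noteq> 0" "q \<noteq> 0"
  shows "total_degree p + total_degree q \<le> total_degree (p * q)"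
proof -
  obtain u where u: "coeff (on_line u p) (total_degree p) \<noteq> 0" "coeff (on_line u q) (total_degree q) \<noteq> 0"
    using exists_line[of "{p, q}"] assms by auto
  hence "on_line u p \<noteq> 0" "on_line u q \<noteq> 0"
    by auto
  have "total_degree p + total_degree q \<le> degree (on_line u p) + degree (on_line u q)"
    using u by (intro add_mono le_degree)
  also have "\<dots> = degree (on_line u (p * q))"
    using \<open>on_line u p \<noteq> 0\<close> \<open>on_line u q \<noteq> 0\<close> by (simp add: on_line_mult degree_mult_eq)
  also have "\<dots> \<le> total_degree (p * q)"
    by (rule degree_on_line_le)
  finally show ?thesis .
qed

lemma lookup_mpoly_const_mult:
  fixes p :: "('n::finite, 'r::comm_ring_1) mpoly"
  shows "Poly_Mapping.lookup (mpoly_const c * p) m = c * Poly_Mapping.lookup p m"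
proof (induction p rule: mpoly_induct)
  case (add_term p d k)
  thus ?case
    by (simp add: distrib_left lookup_add mult_single lookup_single when_def)
qed simp

text \<open>Separates the two tasks: \<open>split\<close> leaves only constant factors, and
  \<open>primitive\<close> makes these units.\<close>

lemma irreducible_mpolyI:
  fixes p :: "('n::finite, 'r::idom) mpoly"
  assumes inf: "infinite (UNIV :: 'r set)" and pos: "0 < total_degree p"
    and split: "\<And>g h. p = g * h \<Longrightarrow> total_degree g = 0 \<or> total_degree h = 0"
    and primitive: "\<And>c. (\<And>m. c dvd Poly_Mapping.lookup p m) \<Longrightarrow> c dvd 1"
  shows "irreducible p"
proof (rule irreducibleI)
  show "p \<noteq> 0"
    using pos by (auto simp: total_degree_def)
  show "\<not> p dvd 1"
  proof
    assume "p dvd 1"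
    then obtain q where q: "p * q = 1"
      by (metis dvdE)
    have "total_degree p + total_degree q \<le> total_degree (p * q)"
      using q \<open>p \<noteq> 0\<close> by (intro total_degree_mult_ge inf) auto
    also have "\<dots> = 0"
      by (simp add: q total_degree_def monom_degree_eq_0_iff)
    finally show False
      using pos by simp
  qed
  have unit: "g dvd 1" if gh: "p = g * h" and "total_degree g = 0" for g h
  proof -
    obtain c where g: "g = mpoly_const c"
      using \<open>total_degree g = 0\<close> total_degree_eq_0_iff by auto
    have "c dvd 1"
      by (rule primitive) (simp add: gh g lookup_mpoly_const_mult)
    then obtain d where "1 = c * d" ..
    hence "g * mpoly_const d = 1"
      by (simp add: g mult_single)
    thus ?thesis by (metis dvd_triv_left)
  qed
  fix g h assume "p = g * h"
  thus "g dvd 1 \<or> h dvd 1"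
    using split unit by (metis mult.commute)
qed

section \<open>Irreducible summands\<close>

lemma product_formula_domain_fract:
  assumes "product_formula_field TYPE('r::idom fract)"
  shows "\<exists>S (v :: ('r fract \<Rightarrow> real) set \<Rightarrow> 'r \<Rightarrow> real) \<beta>. product_formula_domain S v \<beta>"
proof -
  from assms obtain S :: "('r fract \<Rightarrow> real) set set" and nv \<beta> where
    *: "S \<noteq> {} \<and> S \<subseteq> field_primes \<and> (\<forall>P\<in>S. nv P \<in> P) \<and> (\<forall>P\<in>S. \<beta> P > 0) \<and>
        (\<forall>a. a \<noteq> 0 \<longrightarrow> finite {P\<in>S. nv P a \<noteq> 1} \<and> (\<Prod>P | P \<in> S \<and> nv P a \<noteq> 1. nv P a powr \<beta> P) = 1)"
    unfolding product_formula_field_def by (elim exE)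
  hence S: "S \<noteq> {}" "S \<subseteq> field_primes" and nv: "\<And>P. P \<in> S \<Longrightarrow> nv P \<in> P" and \<beta>: "\<And>P. P \<in> S \<Longrightarrow> 0 < \<beta> P"
    and pf: "\<And>a. a \<noteq> 0 \<Longrightarrow> finite {P \<in> S. nv P a \<noteq> 1}"
      "\<And>a. a \<noteq> 0 \<Longrightarrow> (\<Prod>P | P \<in> S \<and> nv P a \<noteq> 1. nv P a powr \<beta> P) = 1"
    by simp_all
  have "nontrivial_absolute_value (nv P)" if "P \<in> S" for P
    using nv[OF that] S(2) that in_quotient_imp_subset[OF equiv_abs_val_equiv, of P]
    unfolding field_primes_def by blast
  hence abs: "absolute_value (nv P)" and nontriv: "\<exists>x. x \<noteq> 0 \<and> nv P x \<noteq> 1" if "P \<in> S" for P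
    using that by (auto simp: nontrivial_absolute_value_def)
  define v where "v = (\<lambda>P r. nv P (Fract r 1))"
  have fract_0: "Fract r 1 = 0 \<longleftrightarrow> r = 0" for r :: 'r
    by (simp add: Zero_fract_def eq_fract)
  have "product_formula_domain S v \<beta>"
  proof (rule product_formula_domain.intro)
    fix P assume "P \<in> S"
    note abs = abs[OF this, unfolded absolute_value_def]
    show "domain_abs (v P)"
    proof unfold_locales
      fix x y :: 'r
      have "Fract (x * y) 1 = Fract x 1 * Fract y 1" "Fract (x + y) 1 = Fract x 1 + Fract y 1"
        by simp_all
      thus "v P (x * y) = v P x * v P y" "v P (x + y) \<le> v P x + v P y"
        using abs unfolding v_def by metis+
    qed (use abs fract_0 in \<open>auto simp: v_def\<close>)
  next
    show "\<exists>P\<in>S. \<exists>a. a \<noteq> 0 \<and> v P a \<noteq> 1"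
    proof -
      obtain P where P: "P \<in> S"
        using S(1) by blast
      then obtain x where x: "x \<noteq> 0" "nv P x \<noteq> 1"
        using nontriv by blast
      obtain a b where ab: "x = Fract a b" "b \<noteq> 0"
        by (cases x) auto
      \<comment> \<open>A fraction with value different from 1 forces its numerator or its
        denominator to have such a value, so the restriction to the domain stays nontrivial.\<close>
      have "Fract a 1 = x * Fract b 1"
        using ab by (simp add: eq_fract)
      hence "v P a = nv P x * v P b"
        using abs[OF P] by (simp add: v_def absolute_value_def)
      moreover have "a \<noteq> 0"
        using x ab by (auto simp: fract_collapse)
      ultimately show ?thesis
        using P x ab by (metis mult.right_neutral)
    qed
  qed (use \<beta> pf fract_0 in \<open>auto simp: v_def\<close>)
  thus ?thesis by blast
qed

theorem corollary1p5:
  fixes Q :: "('n::finite, 'r::{idom, factorial_semiring}) mpoly"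
  assumes "product_formula_field TYPE('r fract)"
    and "CHAR('r fract) > 0 \<Longrightarrow> range (\<lambda>x :: 'r fract. x ^ CHAR('r fract)) \<noteq> UNIV"
    and "\<nexists>c. Q = mpoly_const c"
  shows "\<exists>F G. Q = F + G \<and> irreducible F \<and> irreducible G \<and>
    (\<exists>a b d. F = mpoly_const a + mpoly_term b d \<and> a \<noteq> 0 \<and> b \<noteq> 0 \<and> d \<noteq> 0 \<and>
       total_degree F = monom_degree d \<and> monom_degree d \<le> total_degree Q)"
proof -
  obtain S and v :: "('r fract \<Rightarrow> real) set \<Rightarrow> 'r \<Rightarrow> real" and \<beta> where "product_formula_domain S v \<beta>"
    using product_formula_domain_fract[OF assms(1)] by blast
  then interpret product_formula_domain S v \<beta> .
  note inf = infinite_domain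

  define D where "D = total_degree Q"
  have D: "0 < D"
    using assms(3) total_degree_eq_0_iff[of Q] by (auto simp: D_def)
  hence "Q \<noteq> 0"
    by (auto simp: D_def total_degree_def)
  then obtain u where u: "\<And>i. u i \<noteq> 0" "coeff (on_line u Q) D \<noteq> 0"
    using exists_line[OF inf, of "{Q}"] by (auto simp: D_def)

  \<comment> \<open>Any variable will do; degree 1 is allowed because \<open>Q\<close> is
    nonconstant.\<close>
  define i :: 'n where "i = undefined"
  define d where "d = Poly_Mapping.single i (1::nat)"
  have d: "monom_degree d = 1" "d \<noteq> 0"
    using monom_degree_eq_0_iff[of d] by (auto simp: d_def)
  define q0 where "q0 = Poly_Mapping.lookup Q 0"
  define q1 where "q1 = Poly_Mapping.lookup Q d"
  txt \<open>
    With \<open>a\<close> and \<open>q0 - a\<close> comaximal, \<open>b\<close> can be prescribed modulo both, so that the coefficients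
    of \<open>F\<close> and those of \<open>G\<close> generate the unit ideal.
  \<close>
  obtain a x y where a: "a \<noteq> 0" "a \<noteq> q0" and xy: "x * a + y * (q0 - a) = 1"
  \<comment> \<open>If \<open>q0\<close> is not 1, the unit 1 serves as \<open>a\<close>. Otherwise
    \<open>a\<close> and \<open>q0 - a\<close> already sum to 1.\<close>
  proof (cases "q0 = 1")
    case True
    obtain a :: 'r where "a \<notin> {0, 1}"
      using ex_new_if_finite[OF inf, of "{0, 1}"] by auto
    with True that[of a 1 1] show ?thesis by simp
  next
    case False
    with that[of 1 1 0] show ?thesis by simp
  qed
  \<comment> \<open>Chinese remainders: \<open>B\<close> is 1 modulo \<open>a\<close> and
    \<open>q1 - 1\<close> modulo \<open>q0 - a\<close>. Adding multiples of \<open>A\<close>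
    preserves both congruences.\<close>
  define B where "B = y * (q0 - a) + x * a * (q1 - 1)"
  define A where "A = a * (q0 - a)"
  define b where "b = (\<lambda>z. B + A * z)"
  have b_mod_a: "b z - a * (x * (q1 - 2) + (q0 - a) * z) = 1" for z
  proof -
    have "b z - a * (x * (q1 - 2) + (q0 - a) * z) = x * a + y * (q0 - a)"
      by (simp add: b_def A_def B_def algebra_simps)
    thus ?thesis
      using xy by simp
  qed
  have b_mod_c: "q1 - b z + (q0 - a) * (y * (2 - q1) + a * z) = 1" for z
  proof -
    have "q1 - b z + (q0 - a) * (y * (2 - q1) + a * z) = q1 - (q1 - 1) * (x * a + y * (q0 - a))"
      by (simp add: b_def A_def B_def algebra_simps)
    thus ?thesis
      using xy by simp
  qed
  have "A \<noteq> 0"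
    using a by (simp add: A_def)
  hence "inj b"
    by (auto simp: inj_def b_def)
  \<comment> \<open>Excluding these \<open>z\<close> keeps the monomial \<open>d\<close> present in
    both \<open>F\<close> and \<open>G\<close>.\<close>
  hence fin: "finite (b -` {0, q1})"
    by (intro finite_vimageI) auto

  define H where "H = on_line u Q - [:a, B * u i:]"
  have "coeff H 0 \<noteq> 0"
    using a by (simp add: H_def coeff_on_line_0 q0_def)
  moreover have "- (A * u i) \<noteq> 0"
    using \<open>A \<noteq> 0\<close> u by simp
  ultimately have "\<exists>z. z \<notin> b -` {0, q1} \<and>
      (\<forall>g h. H + monom (- (A * u i) * z) 1 = g * h \<longrightarrow> degree g = 0 \<or> degree h = 0)"
    by (rule exists_indecomposable_translate[OF _ _ fin])
  then obtain z where z: "b z \<noteq> 0" "b z \<noteq> q1"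
    and split: "\<And>g h. H + monom (- (A * u i) * z) 1 = g * h \<Longrightarrow> degree g = 0 \<or> degree h = 0"
    by blast

  define F where "F = mpoly_const a + mpoly_term (b z) d"
  define G where "G = Q - F"
  have F_0: "Poly_Mapping.lookup F 0 = a" and F_d: "Poly_Mapping.lookup F d = b z"
    using d by (auto simp: F_def lookup_add lookup_single when_def)
  have keys_F: "Poly_Mapping.keys F \<subseteq> {0, d}"
    by (auto simp: F_def lookup_add lookup_single in_keys_iff when_def split: if_splits)
  have deg_F: "total_degree F = 1"
  proof (rule antisym)
    show "total_degree F \<le> 1"
      unfolding total_degree_le_iff
    proof
      fix m assume "m \<in> Poly_Mapping.keys F"
      hence "m = 0 \<or> m = d"
        using keys_F by blast
      thus "monom_degree m \<le> 1"
        using d monom_degree_eq_0_iff[of m] by auto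
    qed
    show "1 \<le> total_degree F"
      using monom_degree_le_total_degree[of d F] z d F_d by (simp add: in_keys_iff)
  qed
  have tdeg_mult: "total_degree g + total_degree h \<le> total_degree p" if "p = g * h" "0 < total_degree p"
    for p g h :: "('n, 'r) mpoly"
  proof -
    have "p \<noteq> 0"
      using that by (auto simp: total_degree_def)
    hence "g \<noteq> 0" "h \<noteq> 0"
      using that by auto
    thus ?thesis
      using total_degree_mult_ge[OF inf, of g h] that by simp
  qed
  have "irreducible F"
  proof (rule irreducible_mpolyI[OF inf])
    fix g h assume "F = g * h"
    thus "total_degree g = 0 \<or> total_degree h = 0"
      using tdeg_mult[of F g h] deg_F by auto
  next
    fix c assume "\<And>m. c dvd Poly_Mapping.lookup F m"
    hence "c dvd a" "c dvd b z"
      using F_0 F_d by metis+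
    hence "c dvd b z - a * (x * (q1 - 2) + (q0 - a) * z)"
      by (intro dvd_diff dvd_mult2)
    thus "c dvd 1"
      by (simp only: b_mod_a)
  qed (simp add: deg_F)

  have G_0: "Poly_Mapping.lookup G 0 = q0 - a" and G_d: "Poly_Mapping.lookup G d = q1 - b z"
    by (auto simp: G_def lookup_minus F_0 F_d q0_def q1_def)
  have deg_G: "0 < total_degree G"
    using monom_degree_le_total_degree[of d G] z d G_d by (simp add: in_keys_iff)
  have deg_G_le: "total_degree G \<le> D"
    unfolding total_degree_le_iff
  proof
    fix m assume "m \<in> Poly_Mapping.keys G"
    hence "m \<in> Poly_Mapping.keys Q \<or> m \<in> {0, d}"
      using keys_F by (auto simp: G_def lookup_minus in_keys_iff)
    thus "monom_degree m \<le> D"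
      using monom_degree_le_total_degree[of m Q] monom_degree_eq_0_iff[of m] D d by (auto simp: D_def)
  qed
  have "on_line u F = [:a, b z * u i:]"
    using monom_degree_eq_0_iff[of "0 :: 'n \<Rightarrow>\<^sub>0 nat"] by (simp add: F_def on_line_add d d_def monom_0 monom_Suc)
  moreover have "on_line u Q = on_line u G + on_line u F"
    by (simp add: G_def flip: on_line_add)
  ultimately have line_G: "on_line u G = on_line u Q - [:a, b z * u i:]"
    by simp
  also have "\<dots> = H + monom (- (A * u i) * z) 1"
    by (simp add: H_def b_def monom_Suc monom_0 algebra_simps)
  finally have H_eq: "on_line u G = H + monom (- (A * u i) * z) 1" .
  have "irreducible G"
  proof (rule irreducible_mpolyI[OF inf deg_G])
    fix g h assume gh: "G = g * h"
    note sum_le = tdeg_mult[OF gh deg_G]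
    show "total_degree g = 0 \<or> total_degree h = 0"
    proof (cases "D = 1")
      case True
      thus ?thesis
        using sum_le deg_G_le by linarith
    next
      case False
      \<comment> \<open>For \<open>D\<close> above 1, subtracting \<open>F\<close> leaves the top
        coefficient on the line unchanged; for \<open>D = 1\<close> it could vanish, hence the case
        distinction.\<close>
      hence "coeff [:a, b z * u i:] D = 0"
        using D by (intro coeff_eq_0) auto
      hence "coeff (on_line u G) D \<noteq> 0"
        using u unfolding line_G by simp
      hence "D \<le> degree (on_line u g * on_line u h)"
        by (simp add: gh on_line_mult le_degree)
      also have "\<dots> \<le> degree (on_line u g) + degree (on_line u h)"
        by (rule degree_mult_le)
      \<comment> \<open>The total degrees of \<open>g\<close> and \<open>h\<close> sum to at most
        \<open>D\<close>, so both are preserved on the line, and a factor constant there is itself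
        constant.\<close>
      finally have "D \<le> degree (on_line u g) + degree (on_line u h)" .
      moreover have "degree (on_line u g) = 0 \<or> degree (on_line u h) = 0"
        using split H_eq by (simp add: gh on_line_mult)
      ultimately show ?thesis
        using degree_on_line_le[of u g] degree_on_line_le[of u h] sum_le deg_G_le by linarith
    qed
  next
    fix c assume "\<And>m. c dvd Poly_Mapping.lookup G m"
    hence "c dvd q0 - a" "c dvd q1 - b z"
      using G_0 G_d by metis+
    hence "c dvd q1 - b z + (q0 - a) * (y * (2 - q1) + a * z)"
      by (intro dvd_add dvd_mult2)
    thus "c dvd 1"
      by (simp only: b_mod_c)
  qed
  moreover have "Q = F + G"
    by (simp add: G_def)
  ultimately show ?thesis
    using \<open>irreducible F\<close> a z d deg_F D unfolding F_def D_def
    by (intro exI[of _ F] exI[of _ G] conjI exI[of _ a] exI[of _ "b z"] exI[of _ d]) (auto simp: F_def)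
qed

end
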